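(* Assume $M<0$, $N\ge3$ and $p\ge\frac{N+2}{N-2}$. Then there exist ground states $u$ of (E). Moreover they satisfy $u(r)\sim U_M(r)$ as $r\to\infty$.
   Context: (E) denotes the ODE $-u_{rr}-\frac{N-1}{r}u_r=|u|^{p-1}u+M|u_r|^{\frac{2p}{p+1}}$ for $r>0$. A ground state is a nonnegative $u\in C^2([0,\infty))$ with $u_r(0)=0$ solving (E) on $(0,\infty)$. With $K=\frac{(N-2)p-N}{p-1}$, for $N\ge3$, $p\ge\frac{N}{N-2}$, $M<0$ the equation $X^{p-1}+M\left(\frac{2}{p-1}\right)^{\frac{2p}{p+1}}X^{\frac{p-1}{p+1}}-\frac{2K}{p-1}=0$ has a unique positive root $X_M$, and $U_M(r)=X_Mr^{-\frac{2}{p-1}}$. $f\sim g$ means $f/g\to1$. *)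

theory Defs
  imports "HOL-Analysis.Analysis" "HOL-Library.Landau_Symbols"
begin

definition ground_state :: "nat \<Rightarrow> real \<Rightarrow> real \<Rightarrow> (real \<Rightarrow> real) \<Rightarrow> bool" where
  "ground_state N p M u \<longleftrightarrow>
     (\<forall>r\<ge>0. u r \<ge> 0) \<and>
     (\<exists>u1 u2.
        (\<forall>r\<ge>0. (u has_real_derivative u1 r) (at r within {0..})) \<and>
        (\<forall>r\<ge>0. (u1 has_real_derivative u2 r) (at r within {0..})) \<and>
        continuous_on {0..} u2 \<and>
        u1 0 = 0 \<and>
        (\<forall>r>0. - u2 r - (real N - 1) / r * u1 r
                 = \<bar>u r\<bar> powr (p - 1) * u r + M * \<bar>u1 r\<bar> powr (2 * p / (p + 1))))"

definition K_const :: "nat \<Rightarrow> real \<Rightarrow> real" where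
  "K_const N p = ((real N - 2) * p - real N) / (p - 1)"

definition X_M :: "nat \<Rightarrow> real \<Rightarrow> real \<Rightarrow> real" where
  "X_M N p M = (THE X. X > 0 \<and>
      X powr (p - 1) + M * (2 / (p - 1)) powr (2 * p / (p + 1)) * X powr ((p - 1) / (p + 1))
        - 2 * K_const N p / (p - 1) = 0)"

definition U_M :: "nat \<Rightarrow> real \<Rightarrow> real \<Rightarrow> real \<Rightarrow> real" where
  "U_M N p M r = X_M N p M * r powr (- 2 / (p - 1))"

end

theory Submission
  imports Defs
begin

text \<open>Put \<open>m = - M\<close>, \<open>\<alpha> = 2 / (p - 1)\<close>, \<open>q = 2 p / (p + 1)\<close> and \<open>x t = r powr \<alpha> * u r\<close> with \<open>r = exp t\<close>. The
  equation is invariant under scaling, so where \<open>u\<close> is positive and decreasing it becomes the autonomous equation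
  \<open>x'' = - L x' + \<alpha> K x - x powr p + m (\<alpha> x - x') powr q\<close> with \<open>L = N - 2 - 2 \<alpha>\<close>, and \<open>L \<ge> 0\<close> says
  exactly that \<open>p\<close> is at least \<open>(N + 2) / (N - 2)\<close>. Freezing the gradient term at \<open>x' = 0\<close> yields a conservative
  equation, whose energy decreases along the full flow: the error
  \<open>m x' ((\<alpha> x - x') powr q - (\<alpha> x) powr q)\<close> is nonpositive because \<open>s powr q\<close> is increasing.

  A solution regular at the origin has zero energy at \<open>t = - \<infinity>\<close>, hence negative energy later on. Since the energy is
  nonnegative where \<open>x = 0\<close>, the regular solution of the Cauchy problem never vanishes, and it is a ground state.
  Conversely, every nontrivial ground state is positive and decreasing, negative energy confines \<open>x\<close> to a compact
  subset of the positive axis, the dissipation forces \<open>x'\<close> to tend to 0, and then \<open>x\<close> converges to the unique rest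
  point \<open>X_M\<close>.\<close>

section \<open>Real functions\<close>

text \<open>The mean value theorem, using the derivative only on the open interval since the base
  may be 0 at the left end; the exponent \<open>c - 1\<close> is nonnegative, so the derivative is
  at most its value at \<open>b\<close>.\<close>

lemma powr_lipschitz:
  fixes x y b c :: real
  assumes c: "1 \<le> c" and xy: "0 \<le> x" "x \<le> b" "0 \<le> y" "y \<le> b"
  shows "\<bar>x powr c - y powr c\<bar> \<le> c * b powr (c - 1) * \<bar>x - y\<bar>"
proof -
  have *: "\<bar>x powr c - y powr c\<bar> \<le> c * b powr (c - 1) * \<bar>x - y\<bar>"
    if xy: "0 \<le> x" "x < y" "y \<le> b" for x y :: real
  proof -
    have cont: "continuous_on {x..y} (\<lambda>z. z powr c)"
      using xy c by (intro continuous_on_powr' continuous_intros) auto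
    have der: "((\<lambda>z. z powr c) has_derivative (\<lambda>h. h * (c * z powr (c - 1)))) (at z)" if "x < z" "z < y" for z
      using has_real_derivative_powr[of z c] that xy
      by (simp add: has_field_derivative_def mult_commute_abs)
    obtain z where z: "x < z" "z < y" "y powr c - x powr c = (y - x) * (c * z powr (c - 1))"
      using mvt[OF xy(2) cont der] by blast
    have "z powr (c - 1) \<le> b powr (c - 1)"
      using z xy c by (intro powr_mono2) auto
    then show ?thesis
      using z xy c by (simp add: abs_minus_commute[of "x powr c"] abs_mult mult_mono mult.commute)
  qed
  show ?thesis
    using *[of x y] *[of y x] xy
    by (cases x y rule: linorder_cases) (auto simp: abs_minus_commute)
qed

lemma powr_chord:
  fixes A w c :: real
  assumes "1 \<le> c" "0 < A" "0 \<le> w"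
  shows "A powr (c - 1) * (A - w)\<^sup>2 \<le> (A - w) * (A powr c - w powr c)"
proof -
  have A: "A powr c = A * A powr (c - 1)"
    using assms by (simp add: powr_mult_base)
  have w: "w powr c = w * w powr (c - 1)"
    using assms by (cases "w = 0") (simp_all add: powr_mult_base)
  have "0 \<le> (A - w) * (A powr (c - 1) - w powr (c - 1))"
  proof (cases "w \<le> A")
    case True
    then show ?thesis using assms by (intro mult_nonneg_nonneg) (auto intro: powr_mono2)
  next
    case False
    then show ?thesis using assms by (intro mult_nonpos_nonpos) (auto intro: powr_mono2)
  qed
  then have "0 \<le> w * ((A - w) * (A powr (c - 1) - w powr (c - 1)))"
    using assms by simp
  then show ?thesis
    unfolding A w by (simp add: algebra_simps power2_eq_square)
qed

text \<open>While \<open>\<phi>\<close> stays above half of \<open>\<phi> t\<close> on an interval of length \<open>\<phi> t / (2 C)\<close>, the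
  function \<open>f\<close> loses at least \<open>(\<phi> t)\<^sup>2 / (4 C)\<close>.\<close>

lemma dissipation_tendsto_zero:
  fixes f \<phi> f' :: "real \<Rightarrow> real"
  assumes der: "\<And>t. t0 \<le> t \<Longrightarrow> (f has_real_derivative f' t) (at t)"
    and le: "\<And>t. t0 \<le> t \<Longrightarrow> f' t \<le> - \<phi> t"
    and nonneg: "\<And>t. t0 \<le> t \<Longrightarrow> 0 \<le> \<phi> t"
    and lip: "\<And>s t. t0 \<le> s \<Longrightarrow> s \<le> t \<Longrightarrow> \<bar>\<phi> t - \<phi> s\<bar> \<le> C * (t - s)"
    and C: "0 < C"
    and low: "\<And>t. t0 \<le> t \<Longrightarrow> b \<le> f t"
  shows "(\<phi> \<longlongrightarrow> 0) at_top"
proof -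
  have drop: "(t - s) * k \<le> f s - f t"
    if "t0 \<le> s" "s \<le> t" "\<And>z. s \<le> z \<Longrightarrow> z \<le> t \<Longrightarrow> k \<le> \<phi> z" for s t k
  proof (cases "s = t")
    case False
    then have "s < t" using that by simp
    moreover have "(f has_real_derivative f' z) (at z)" if "s \<le> z" "z \<le> t" for z
      using der[of z] that \<open>t0 \<le> s\<close> by simp
    ultimately obtain z where z: "s < z" "z < t" "f t - f s = (t - s) * f' z"
      using MVT2[of s t f f'] by blast
    have "f' z \<le> - k"
      using le[of z] that(3)[of z] z that(1) by force
    then have "(t - s) * f' z \<le> (t - s) * (- k)"
      using that(2) by (intro mult_left_mono) auto
    then show ?thesis using z by simp
  qed simp
  \<comment> \<open>\<open>f\<close> is nonincreasing and bounded below, so this infimum is also its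
    limit, and \<open>f t - l\<close> is the total loss still available after time
    \<open>t\<close>.\<close>
  define l where "l = Inf (f ` {t0..})"
  have bdd: "bdd_below (f ` {t0..})"
    using low by (intro bdd_belowI2[of _ b]) auto
  have l_le: "l \<le> f t" if "t0 \<le> t" for t
    unfolding l_def using bdd that by (intro cINF_lower) auto
  have main: "(\<phi> t)\<^sup>2 \<le> 4 * C * (f t - l)" if "t0 \<le> t" for t
  proof -
    define d where "d = \<phi> t / (2 * C)"
    have d: "0 \<le> d" using nonneg that C by (simp add: d_def)
    have "d * (\<phi> t / 2) \<le> f t - f (t + d)"
    proof -
      have "\<phi> t / 2 \<le> \<phi> z" if z: "t \<le> z" "z \<le> t + d" for z
      proof -
        have "C * (z - t) \<le> C * d" using z C by simp
        also have "\<dots> = \<phi> t / 2" using C by (simp add: d_def)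
        finally show ?thesis using lip[of t z] z \<open>t0 \<le> t\<close> by linarith
      qed
      then show ?thesis using drop[of t "t + d" "\<phi> t / 2"] d that by simp
    qed
    also have "\<dots> \<le> f t - l" using l_le[of "t + d"] that d by simp
    finally show ?thesis
      using C by (simp add: d_def field_simps power2_eq_square)
  qed
  have lim: "(f \<longlongrightarrow> l) at_top"
  proof (rule order_tendstoI)
    fix a assume "a < l"
    then show "eventually (\<lambda>t. a < f t) at_top"
      using less_le_trans[OF _ l_le] unfolding eventually_at_top_linorder by blast
  next
    fix a assume "l < a"
    then obtain t1 where t1: "t0 \<le> t1" "f t1 < a"
      unfolding l_def using cINF_less_iff[OF _ bdd] by force
    have "f t \<le> f t1" if "t1 \<le> t" for t
      using drop[of t1 t 0] nonneg t1 that by force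
    then show "eventually (\<lambda>t. f t < a) at_top"
      using t1(2) le_less_trans unfolding eventually_at_top_linorder by blast
  qed
  have "((\<lambda>t. 4 * C * (f t - l)) \<longlongrightarrow> 4 * C * (l - l)) at_top"
    by (intro tendsto_intros lim)
  then have "((\<lambda>t. (\<phi> t)\<^sup>2) \<longlongrightarrow> 0) at_top"
    using main
    by (intro tendsto_sandwich[of "\<lambda>_. 0" "\<lambda>t. (\<phi> t)\<^sup>2"])
      (auto simp: eventually_at_top_linorder)
  then show ?thesis by (simp add: tendsto_null_power)
qed

text \<open>A Barbalat-type argument: over a short window the increment of \<open>y\<close> is
  small, so its slope, and with it \<open>G\<close>, is small at some point of the window; the
  Lipschitz bound carries this back to the start.\<close>

lemma slope_tendsto_zero:
  fixes y G \<epsilon> :: "real \<Rightarrow> real"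
  assumes der: "\<And>t. t0 \<le> t \<Longrightarrow> (y has_real_derivative \<epsilon> t - G t) (at t)"
    and lip: "\<And>s t. t0 \<le> s \<Longrightarrow> s \<le> t \<Longrightarrow> \<bar>G t - G s\<bar> \<le> C * (t - s)"
    and C: "0 < C"
    and y: "(y \<longlongrightarrow> 0) at_top" and \<epsilon>: "(\<epsilon> \<longlongrightarrow> 0) at_top"
  shows "(G \<longlongrightarrow> 0) at_top"
proof (rule tendstoI)
  fix e :: real assume e: "0 < e"
  \<comment> \<open>\<open>G\<close> varies by at most \<open>e / 4\<close> over a window of this
    length, and the threshold \<open>h * e / 8\<close> at both ends keeps the mean slope of
    \<open>y\<close> within \<open>e / 4\<close>.\<close>
  define h where "h = e / (4 * C)"
  have h: "0 < h" using e C by (simp add: h_def)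
  have "eventually (\<lambda>t. \<bar>y t\<bar> < h * e / 8) at_top" "eventually (\<lambda>t. \<bar>\<epsilon> t\<bar> < e / 4) at_top"
    using tendstoD[OF y, of "h * e / 8"] tendstoD[OF \<epsilon>, of "e / 4"] h e by auto
  then have "eventually (\<lambda>t. t0 \<le> t \<and> \<bar>y t\<bar> < h * e / 8 \<and> \<bar>\<epsilon> t\<bar> < e / 4) at_top"
    using eventually_ge_at_top[of t0] by eventually_elim auto
  then obtain t1 where t1: "\<And>t. t1 \<le> t \<Longrightarrow> t0 \<le> t \<and> \<bar>y t\<bar> < h * e / 8 \<and> \<bar>\<epsilon> t\<bar> < e / 4"
    by (auto simp: eventually_at_top_linorder)
  have "dist (G t) 0 < e" if t: "t1 \<le> t" for t
  proof -
    obtain z where z: "t < z" "z < t + h" "y (t + h) - y t = h * (\<epsilon> z - G z)"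
      using MVT2[of t "t + h" y "\<lambda>t. \<epsilon> t - G t"] der h t1[OF t] by force
    have "\<bar>h * (\<epsilon> z - G z)\<bar> \<le> h * (e / 4)"
      unfolding z(3)[symmetric] using t1[of t] t1[of "t + h"] t h by linarith
    then have "\<bar>\<epsilon> z - G z\<bar> \<le> e / 4"
      using h by (simp add: abs_mult)
    moreover have "\<bar>G z - G t\<bar> \<le> e / 4"
    proof -
      have "\<bar>G z - G t\<bar> \<le> C * (z - t)" using lip[of t z] z t1[OF t] by simp
      also have "\<dots> \<le> C * h" using z C by simp
      finally show ?thesis using C by (simp add: h_def)
    qed
    moreover have "\<bar>\<epsilon> z\<bar> < e / 4" using t1[of z] z t by simp
    ultimately show ?thesis using e unfolding dist_real_def by linarith
  qed
  then show "eventually (\<lambda>t. dist (G t) 0 < e) at_top"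
    unfolding eventually_at_top_linorder by blast
qed

lemma lipschitz_from_derivative:
  fixes f f' :: "real \<Rightarrow> real"
  assumes der: "\<And>t. t0 \<le> t \<Longrightarrow> (f has_real_derivative f' t) (at t)"
    and bound: "\<And>t. t0 \<le> t \<Longrightarrow> \<bar>f' t\<bar> \<le> C"
    and st: "t0 \<le> s" "s \<le> t"
  shows "\<bar>f t - f s\<bar> \<le> C * (t - s)"
proof -
  have "norm (f t - f s) \<le> C * norm (t - s)"
  proof (rule field_differentiable_bound[of "{t0..}"])
    show "(f has_field_derivative f' z) (at z within {t0..})" if "z \<in> {t0..}" for z
      using der[of z] that by (auto intro: has_field_derivative_at_within)
  qed (use bound st in auto)
  then show ?thesis using st by simp
qed

section \<open>First zeros, barriers and Gronwall estimates\<close>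

lemma first_zero:
  fixes f :: "real \<Rightarrow> real"
  assumes cont: "continuous_on {a..b} f" and "a \<le> b" "0 < f a" "f b \<le> 0"
  obtains z where "a < z" "z \<le> b" "f z = 0" "\<And>s. a \<le> s \<Longrightarrow> s < z \<Longrightarrow> 0 < f s"
proof -
  \<comment> \<open>The least point of this compact set is the zero sought: a nonpositive value
    before it would produce an earlier zero.\<close>
  define Z where "Z = {s \<in> {a..b}. f s = 0}"
  have "compact Z"
  proof -
    have "closed Z"
      unfolding Z_def using continuous_closed_preimage_constant[OF cont, of 0] by simp
    moreover have "Z \<subseteq> {a..b}" by (auto simp: Z_def)
    ultimately show ?thesis by (meson bounded_closed_interval bounded_subset compact_eq_bounded_closed)
  qed
  moreover have "Z \<noteq> {}"
    using IVT2'[of f b 0 a] assms by (auto simp: Z_def)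
  ultimately obtain z where z: "z \<in> Z" "\<And>s. s \<in> Z \<Longrightarrow> z \<le> s"
    using compact_attains_inf by metis
  have zab: "a \<le> z" "z \<le> b" "f z = 0" using z by (auto simp: Z_def)
  moreover have "a \<noteq> z" using zab assms by auto
  moreover have "0 < f s" if s: "a \<le> s" "s < z" for s
  proof (rule ccontr)
    assume "\<not> 0 < f s"
    moreover have "continuous_on {a..s} f"
      using s zab by (intro continuous_on_subset[OF cont]) auto
    ultimately obtain c where "a \<le> c" "c \<le> s" "f c = 0"
      using IVT2'[of f s 0 a] assms s by auto
    then have "z \<le> c" using z(2)[of c] s zab by (simp add: Z_def)
    then show False using \<open>c \<le> s\<close> s by simp
  qed
  ultimately show ?thesis using that[of z] by simp
qed

text \<open>If \<open>f b\<close> exceeded \<open>V\<close>, then \<open>f\<close> would be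
  nonincreasing since the last point where it equals \<open>V\<close>. The derivative is asked for
  only inside the interval, so the left end may be the singular origin.\<close>

lemma barrier:
  fixes f f' :: "real \<Rightarrow> real"
  assumes cont: "continuous_on {a..b} f" and ab: "a \<le> b"
    and der: "\<And>s. a < s \<Longrightarrow> s < b \<Longrightarrow> (f has_real_derivative f' s) (at s)"
    and le: "\<And>s. a < s \<Longrightarrow> s < b \<Longrightarrow> V < f s \<Longrightarrow> f' s \<le> 0"
    and init: "f a \<le> V"
  shows "f b \<le> V"
proof (rule ccontr)
  assume "\<not> f b \<le> V"
  \<comment> \<open>Running backwards from \<open>b\<close> turns the last crossing of
    \<open>V\<close> into a first zero.\<close>
  moreover have "continuous_on {0..b - a} (\<lambda>s. f (b - s) - V)"
    by (intro continuous_intros continuous_on_compose2[OF cont]) auto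
  ultimately obtain z where z: "0 < z" "z \<le> b - a" "f (b - z) - V = 0"
    "\<And>s. 0 \<le> s \<Longrightarrow> s < z \<Longrightarrow> 0 < f (b - s) - V"
    using first_zero[of 0 "b - a" "\<lambda>s. f (b - s) - V"] ab init by auto
  have "f (b - z) \<ge> f b"
  proof (rule DERIV_nonpos_imp_decreasing_open[of "b - z" b f])
    show "\<exists>D. (f has_real_derivative D) (at s) \<and> D \<le> 0" if s: "b - z < s" "s < b" for s
      using der[of s] le[of s] z(4)[of "b - s"] z s by force
    show "continuous_on {b - z..b} f" using cont z by (rule_tac continuous_on_subset) auto
  qed (use z in simp)
  then show False using z \<open>\<not> f b \<le> V\<close> by simp
qed

text \<open>The integrating factor \<open>exp (- C * s)\<close> makes the product nonincreasing. For
  a sum of squares \<open>H\<close> the conclusion means that a zero propagates to the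
  right.\<close>

lemma gronwall_zero_forward:
  fixes H H' :: "real \<Rightarrow> real"
  assumes cont: "continuous_on {a..b} H" and ab: "a \<le> b"
    and der: "\<And>s. a < s \<Longrightarrow> s < b \<Longrightarrow> (H has_real_derivative H' s) (at s)"
    and le: "\<And>s. a < s \<Longrightarrow> s < b \<Longrightarrow> H' s \<le> C * H s"
    and zero: "H a = 0"
  shows "H b \<le> 0"
proof -
  have "exp (- C * b) * H b \<le> exp (- C * a) * H a"
  proof (rule DERIV_nonpos_imp_decreasing_open[OF ab, of "\<lambda>s. exp (- C * s) * H s"])
    fix s assume s: "a < s" "s < b"
    have "((\<lambda>s. exp (- C * s) * H s) has_real_derivative exp (- C * s) * (H' s - C * H s)) (at s)"
      by (rule derivative_eq_intros der s refl)+ (simp add: algebra_simps)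
    moreover have "exp (- C * s) * (H' s - C * H s) \<le> 0"
      using le[OF s] by (simp add: mult_nonneg_nonpos)
    ultimately show "\<exists>D. ((\<lambda>s. exp (- C * s) * H s) has_real_derivative D) (at s) \<and> D \<le> 0" by blast
  qed (intro continuous_intros cont)
  then show ?thesis using zero by (simp add: mult_le_0_iff)
qed

lemma gronwall_zero_backward:
  fixes H H' :: "real \<Rightarrow> real"
  assumes cont: "continuous_on {a..b} H" and ab: "a \<le> b"
    and der: "\<And>s. a < s \<Longrightarrow> s < b \<Longrightarrow> (H has_real_derivative H' s) (at s)"
    and ge: "\<And>s. a < s \<Longrightarrow> s < b \<Longrightarrow> - C * H s \<le> H' s"
    and zero: "H b = 0"
  shows "H a \<le> 0"
proof (rule gronwall_zero_forward[of "- b" "- a" "\<lambda>s. H (- s)" "\<lambda>s. - H' (- s)" C, simplified])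
  show "continuous_on {- b..- a} (\<lambda>s. H (- s))"
    by (intro continuous_on_compose2[OF cont] continuous_intros) auto
  show "((\<lambda>s. H (- s)) has_real_derivative - H' (- s)) (at s)" if "- b < s" "s < - a" for s
    using der[of "- s"] that by (subst DERIV_mirror[symmetric]) simp
  show "- H' (- s) \<le> C * H (- s)" if "- b < s" "s < - a" for s
    using ge[of "- s"] that by simp
qed (use ab zero in auto)

section \<open>The radial Cauchy problem\<close>

lemma integral_real_derivative_open:
  fixes g :: "real \<Rightarrow> real"
  assumes "continuous_on {0..} g" "0 < r"
  shows "((\<lambda>r. integral {0..r} g) has_real_derivative g r) (at r)"
proof -
  have "((\<lambda>r. integral {0..r} g) has_real_derivative g r) (at r within {0..r + 1})"
    using assms by (intro integral_has_real_derivative continuous_on_subset[OF assms(1)]) auto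
  moreover have "at r within {0..r + 1} = at r"
    using assms by (intro at_within_interior) auto
  ultimately show ?thesis by simp
qed

text \<open>The weight \<open>(s / r) ^ n\<close> is at most 1, so the averaging costs nothing and
  the estimate is uniform down to the singular origin.\<close>

lemma averaged_integral_bound:
  fixes h k :: "real \<Rightarrow> real"
  assumes cont: "continuous_on {0..r} h" "continuous_on {0..r} k" and r: "0 < r"
    and le: "\<And>s. 0 \<le> s \<Longrightarrow> s \<le> r \<Longrightarrow> \<bar>h s\<bar> \<le> k s"
  shows "\<bar>integral {0..r} (\<lambda>s. s ^ n * h s) / r ^ n\<bar> \<le> integral {0..r} k"
proof -
  have k: "0 \<le> k s" if "0 \<le> s" "s \<le> r" for s using le[OF that] by linarith
  have "norm (integral {0..r} (\<lambda>s. s ^ n * h s)) \<le> integral {0..r} (\<lambda>s. r ^ n * k s)"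
  proof (rule integral_norm_bound_integral)
    show "(\<lambda>s. s ^ n * h s) integrable_on {0..r}" "(\<lambda>s. r ^ n * k s) integrable_on {0..r}"
      by (intro integrable_continuous_real continuous_intros cont)+
    show "norm (s ^ n * h s) \<le> r ^ n * k s" if "s \<in> {0..r}" for s
      using that le[of s] k[of s] by (auto simp: abs_mult intro!: mult_mono power_mono)
  qed
  also have "\<dots> = r ^ n * integral {0..r} k" by simp
  finally show ?thesis using r by (simp add: field_simps)
qed

text \<open>The Picard operator of the radial problem \<open>(r\<^sup>n v)' = r\<^sup>n f u v\<close>, \<open>u' = - v\<close>, is a
  contraction for the exponentially weighted norm, the averaging kernel \<open>(s / r)\<^sup>n\<close> being
  at most 1.\<close>

lemma radial_Picard:
  fixes f :: "real \<Rightarrow> real \<Rightarrow> real"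
  assumes lip: "\<And>u u' v v'. \<bar>f u v - f u' v'\<bar> \<le> C * (\<bar>u - u'\<bar> + \<bar>v - v'\<bar>)"
    and bound: "\<And>u v. \<bar>f u v\<bar> \<le> B" and C: "0 \<le> C"
  obtains v :: "real \<Rightarrow> real" where "continuous_on UNIV v"
    "\<And>r. v r = integral {0..r} (\<lambda>s. s ^ n * f (a - integral {0..s} v) (v s)) / r ^ n"
proof -
  \<comment> \<open>Large enough for \<open>2 * C / l\<close> to be at most 1/2, the contraction
    factor below.\<close>
  define l where "l = 4 * C + 1"
  have l: "1 \<le> l" "0 < l" using C by (auto simp: l_def)
  have B: "0 \<le> B" using bound[of 0 0] by linarith
  \<comment> \<open>The fixed point is sought in weighted form, among bounded continuous functions,
    which are complete for the supremum norm; \<open>V\<close> removes the weight.\<close>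
  define V where "V \<phi> s = exp (l * s) * apply_bcontfun \<phi> s" for \<phi> :: "real \<Rightarrow>\<^sub>C real" and s
  define h where "h \<phi> s = f (a - integral {0..s} (V \<phi>)) (V \<phi> s)" for \<phi> s
  define P where "P \<phi> r = integral {0..r} (\<lambda>s. s ^ n * h \<phi> s) / r ^ n" for \<phi> r
  have cont_f: "continuous_on S (\<lambda>s. f (u s) (w s))"
    if "continuous_on S u" "continuous_on S w" for S :: "real set" and u w
    unfolding continuous_on_def
  proof
    fix x assume x: "x \<in> S"
    have "((\<lambda>s. C * (\<bar>u s - u x\<bar> + \<bar>w s - w x\<bar>)) \<longlongrightarrow> C * (\<bar>u x - u x\<bar> + \<bar>w x - w x\<bar>)) (at x within S)"
      using that x by (intro tendsto_intros) (auto simp: continuous_on_def)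
    then have lim: "((\<lambda>s. C * (\<bar>u s - u x\<bar> + \<bar>w s - w x\<bar>)) \<longlongrightarrow> 0) (at x within S)"
      by simp
    have "((\<lambda>s. f (u s) (w s) - f (u x) (w x)) \<longlongrightarrow> 0) (at x within S)"
      by (rule Lim_null_comparison[OF _ lim]) (unfold real_norm_def, intro always_eventually allI lip)
    then show "((\<lambda>s. f (u s) (w s)) \<longlongrightarrow> f (u x) (w x)) (at x within S)"
      by (simp add: LIM_zero_iff)
  qed
  have V_cont: "continuous_on S (V \<phi>)" for \<phi> S
    unfolding V_def by (intro continuous_intros) simp
  have IV_cont: "continuous_on {0..r} (\<lambda>s. integral {0..s} (V \<phi>))" for r \<phi>
    by (intro indefinite_integral_continuous_1 integrable_continuous_real V_cont)
  have h_cont: "continuous_on {0..r} (h \<phi>)" for r \<phi>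
    unfolding h_def by (intro cont_f continuous_intros IV_cont V_cont)
  \<comment> \<open>For nonpositive \<open>r\<close> the integral runs over an empty or one-point
    interval; this extends the operator to functions on the whole line.\<close>
  have P_neg: "P \<phi> r = 0" if "r \<le> 0" for \<phi> r
    using that unfolding P_def by (cases "r = 0") auto
  \<comment> \<open>The linear bound serves twice: for continuity at 0, where the division by
    \<open>r ^ n\<close> is singular, and for boundedness once the weight is applied.\<close>
  have P_bound: "\<bar>P \<phi> r\<bar> \<le> B * r" if "0 < r" for \<phi> r
  proof -
    have "\<bar>P \<phi> r\<bar> \<le> integral {0..r} (\<lambda>_. B)"
      unfolding P_def using that bound
      by (intro averaged_integral_bound h_cont continuous_intros) (auto simp: h_def)
    then show ?thesis using that by (simp add: mult.commute)
  qed
  have P_cont: "continuous_on UNIV (P \<phi>)" for \<phi>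
  proof -
    have pos: "isCont (P \<phi>) r" if "0 < r" for r
    proof -
      have "continuous_on {0..} (\<lambda>s. s ^ n * h \<phi> s)"
        unfolding continuous_on_def
      proof
        fix x :: real assume "x \<in> {0..}"
        moreover have "continuous_on {0..x + 1} (\<lambda>s. s ^ n * h \<phi> s)"
          by (intro continuous_intros h_cont)
        moreover have "at x within {0..} = at x within {0..x + 1}"
          by (rule at_within_nhd[of _ "{x - 1<..<x + 1}"]) auto
        ultimately show "((\<lambda>s. s ^ n * h \<phi> s) \<longlongrightarrow> x ^ n * h \<phi> x) (at x within {0..})"
          by (simp add: continuous_on_def)
      qed
      from DERIV_isCont[OF integral_real_derivative_open[OF this that]] that
      show ?thesis unfolding P_def by (intro continuous_intros) auto
    qed
    have neg: "isCont (P \<phi>) r" if "r < 0" for r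
    proof -
      have "eventually (\<lambda>s. s < 0) (nhds r)" using that by (rule order_tendstoD(2)[OF filterlim_ident])
      then have "eventually (\<lambda>s. P \<phi> s = 0) (nhds r)" by eventually_elim (simp add: P_neg)
      then show ?thesis using isCont_cong[of "P \<phi>" "\<lambda>_. 0" r] by simp
    qed
    have zero: "isCont (P \<phi>) 0"
    proof -
      have "((\<lambda>r. B * \<bar>r\<bar>) \<longlongrightarrow> B * \<bar>0\<bar>) (at 0)" by (intro tendsto_intros)
      moreover have "\<bar>P \<phi> r\<bar> \<le> B * \<bar>r\<bar>" for r
        using P_bound[of r \<phi>] P_neg[of r \<phi>] mult_nonneg_nonneg[OF B abs_ge_zero[of r]]
        by (cases "0 < r") simp_all
      ultimately have "(P \<phi> \<longlongrightarrow> 0) (at 0)"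
        by (intro Lim_null_comparison[of "P \<phi>" "\<lambda>r. B * \<bar>r\<bar>"]) auto
      then show ?thesis by (simp add: isCont_def P_neg)
    qed
    show ?thesis
      using pos neg zero by (metis continuous_at_imp_continuous_on linorder_less_linear)
  qed
  define T where "T \<phi> = Bcontfun (\<lambda>r. exp (- l * r) * P \<phi> r)" for \<phi>
  have T: "apply_bcontfun (T \<phi>) r = exp (- l * r) * P \<phi> r" for \<phi> r
  proof -
    have "(\<lambda>r. exp (- l * r) * P \<phi> r) \<in> bcontfun"
    proof (rule bcontfun_normI)
      show "continuous_on UNIV (\<lambda>r. exp (- l * r) * P \<phi> r)"
        by (intro continuous_intros P_cont)
      show "norm (exp (- l * r) * P \<phi> r) \<le> B" for r
      proof (cases "0 < r")
        case True
        have "\<bar>P \<phi> r\<bar> \<le> B * exp (l * r)"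
        proof -
          have "r \<le> l * r" using l True by simp
          also have "\<dots> \<le> exp (l * r)" using exp_ge_add_one_self[of "l * r"] by linarith
          finally show ?thesis
            using P_bound[OF True, of \<phi>] B mult_left_mono[of r "exp (l * r)" B] by linarith
        qed
        then show ?thesis by (simp add: abs_mult exp_minus field_simps)
      qed (simp add: P_neg B)
    qed
    then show ?thesis unfolding T_def by (simp add: Bcontfun_inverse)
  qed
  have contr: "dist (T \<phi>) (T \<psi>) \<le> 1 / 2 * dist \<phi> \<psi>" for \<phi> \<psi>
  proof (rule dist_bound)
    fix r
    define d where "d = dist \<phi> \<psi>"
    have d: "0 \<le> d" by (simp add: d_def)
    have Vd: "\<bar>V \<phi> s - V \<psi> s\<bar> \<le> d * exp (l * s)" for s
      using dist_bounded[of \<phi> s \<psi>]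
      by (simp add: V_def dist_real_def d_def abs_mult right_diff_distrib[symmetric])
    have int_exp: "integral {0..s} (\<lambda>s. exp (l * s)) = (exp (l * s) - 1) / l" if "0 \<le> s" for s
    proof -
      have "((\<lambda>s. exp (l * s)) has_integral (exp (l * s) / l - exp (l * 0) / l)) {0..s}"
        using that l by (intro fundamental_theorem_of_calculus)
          (auto intro!: derivative_eq_intros simp flip: has_real_derivative_iff_has_vector_derivative)
      then show ?thesis by (simp add: integral_unique diff_divide_distrib)
    qed
    show "dist (T \<phi> r) (T \<psi> r) \<le> 1 / 2 * dist \<phi> \<psi>"
    proof (cases "0 < r")
      case True
      \<comment> \<open>The differences of the \<open>u\<close> and \<open>v\<close> arguments each
        contribute at most \<open>d * exp (l * s)\<close>, hence the factor 2.\<close>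
      have hd: "\<bar>h \<phi> s - h \<psi> s\<bar> \<le> 2 * C * d * exp (l * s)" if s: "0 \<le> s" "s \<le> r" for s
      proof -
        have "\<bar>integral {0..s} (V \<phi>) - integral {0..s} (V \<psi>)\<bar> = norm (integral {0..s} (\<lambda>s. V \<phi> s - V \<psi> s))"
          by (simp add: Henstock_Kurzweil_Integration.integral_diff integrable_continuous_real V_cont)
        also have "\<dots> \<le> integral {0..s} (\<lambda>s. d * exp (l * s))"
          using Vd by (intro integral_norm_bound_integral integrable_continuous_real continuous_intros V_cont) auto
        also have "\<dots> = d * ((exp (l * s) - 1) / l)" using int_exp s by simp
        also have "\<dots> \<le> d * exp (l * s)"
        proof (rule mult_left_mono[OF _ d])
          have "(exp (l * s) - 1) / l \<le> (exp (l * s) - 1) / 1"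
            using l s by (intro divide_left_mono) auto
          then show "(exp (l * s) - 1) / l \<le> exp (l * s)" by simp
        qed
        finally have "\<bar>(a - integral {0..s} (V \<phi>)) - (a - integral {0..s} (V \<psi>))\<bar> + \<bar>V \<phi> s - V \<psi> s\<bar> \<le> 2 * d * exp (l * s)"
          using Vd[of s] by linarith
        then have "C * (\<bar>(a - integral {0..s} (V \<phi>)) - (a - integral {0..s} (V \<psi>))\<bar> + \<bar>V \<phi> s - V \<psi> s\<bar>) \<le> C * (2 * d * exp (l * s))"
          using C by (rule mult_left_mono)
        with lip[of "a - integral {0..s} (V \<phi>)" "V \<phi> s" "a - integral {0..s} (V \<psi>)" "V \<psi> s"]
        show ?thesis unfolding h_def by (simp add: mult_ac)
      qed
      have "P \<phi> r - P \<psi> r = integral {0..r} (\<lambda>s. s ^ n * (h \<phi> s - h \<psi> s)) / r ^ n"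
        unfolding P_def
        by (simp add: right_diff_distrib Henstock_Kurzweil_Integration.integral_diff diff_divide_distrib
            integrable_continuous_real h_cont continuous_intros)
      also have "\<bar>\<dots>\<bar> \<le> integral {0..r} (\<lambda>s. 2 * C * d * exp (l * s))"
        using hd True by (intro averaged_integral_bound continuous_intros h_cont)
      also have "\<dots> = 2 * C * d * ((exp (l * r) - 1) / l)"
        using int_exp[of r] True by simp
      also have "\<dots> \<le> d / 2 * exp (l * r)"
      proof -
        have "2 * C * ((exp (l * r) - 1) / l) \<le> 2 * C * (exp (l * r) / l)"
          using C l by (intro mult_left_mono divide_right_mono) auto
        also have "\<dots> = (2 * C / l) * exp (l * r)" by simp
        also have "\<dots> \<le> 1 / 2 * exp (l * r)"
          using l C by (intro mult_right_mono) (auto simp: l_def field_simps)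
        finally have "d * (2 * C * ((exp (l * r) - 1) / l)) \<le> d * (1 / 2 * exp (l * r))"
          by (rule mult_left_mono[OF _ d])
        then show ?thesis by (simp add: mult_ac)
      qed
      finally have "exp (- l * r) * \<bar>P \<phi> r - P \<psi> r\<bar> \<le> exp (- l * r) * (d / 2 * exp (l * r))"
        by (intro mult_left_mono) auto
      also have "\<dots> = d / 2" by (simp add: exp_minus)
      finally show ?thesis
        by (simp add: T dist_real_def abs_mult right_diff_distrib[symmetric] d_def)
    qed (simp add: T P_neg)
  qed
  obtain \<phi> where \<phi>: "T \<phi> = \<phi>"
    using banach_fix_type[of "1 / 2" T] contr by auto
  have "V \<phi> r = P \<phi> r" for r
  proof -
    have "V \<phi> r = exp (l * r) * apply_bcontfun (T \<phi>) r" by (simp add: V_def \<phi>)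
    then show ?thesis by (simp add: T exp_minus)
  qed
  then show ?thesis
    unfolding P_def h_def by (rule that[OF V_cont])
qed

text \<open>Projection onto the interval from 0 to \<open>b\<close> is nonexpansive, so the
  truncated power is globally Lipschitz, as \<open>radial_Cauchy_problem\<close> asks of its
  nonlinearity.\<close>

lemma clamp_powr_lipschitz:
  fixes c b x y :: real
  assumes "1 \<le> c" "0 \<le> b"
  shows "\<bar>(max 0 (min x b)) powr c - (max 0 (min y b)) powr c\<bar> \<le> c * b powr (c - 1) * \<bar>x - y\<bar>"
proof -
  have "\<bar>(max 0 (min x b)) powr c - (max 0 (min y b)) powr c\<bar>
      \<le> c * b powr (c - 1) * \<bar>max 0 (min x b) - max 0 (min y b)\<bar>"
    using assms by (intro powr_lipschitz) auto
  also have "\<dots> \<le> c * b powr (c - 1) * \<bar>x - y\<bar>"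
    using assms by (intro mult_left_mono) auto
  finally show ?thesis .
qed

text \<open>Integrating the fixed point of \<open>radial_Picard\<close> recovers \<open>u\<close>.
  The limit of \<open>v r / r\<close> is recorded because the equation is singular at the origin,
  where the second derivative of \<open>u\<close> has to be found separately.\<close>

lemma radial_Cauchy_problem:
  fixes f :: "real \<Rightarrow> real \<Rightarrow> real"
  assumes lip: "\<And>u u' v v'. \<bar>f u v - f u' v'\<bar> \<le> C * (\<bar>u - u'\<bar> + \<bar>v - v'\<bar>)"
    and bound: "\<And>u v. \<bar>f u v\<bar> \<le> B" and C: "0 \<le> C" and n: "0 < n"
  obtains u v :: "real \<Rightarrow> real" where "u 0 = a" "v 0 = 0"
    "\<And>r. 0 \<le> r \<Longrightarrow> (u has_real_derivative - v r) (at r within {0..})"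
    "\<And>r. 0 < r \<Longrightarrow> (v has_real_derivative f (u r) (v r) - real n / r * v r) (at r)"
    "((\<lambda>r. v r / r) \<longlongrightarrow> f a 0 / real (Suc n)) (at_right 0)"
    "continuous_on {0..} v" "continuous_on {0..} (\<lambda>r. f (u r) (v r))"
proof -
  obtain v where v_cont: "continuous_on UNIV v"
    and v_eq: "\<And>r. v r = integral {0..r} (\<lambda>s. s ^ n * f (a - integral {0..s} v) (v s)) / r ^ n"
    by (rule radial_Picard[where f = f and C = C and B = B and n = n and a = a, OF lip bound C]) (rule that; assumption)
  define u where "u r = a - integral {0..r} v" for r
  define F where "F s = f (u s) (v s)" for s
  have u_0: "u 0 = a" by (simp add: u_def)
  have v_0: "v 0 = 0" using v_eq[of 0] by simp
  have F_0: "F 0 = f a 0" by (simp add: F_def u_0 v_0)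
  have du: "(u has_real_derivative - v r) (at r within {0..})" if r: "0 \<le> r" for r
  proof -
    have "((\<lambda>r. integral {0..r} v) has_real_derivative v r) (at r within {0..r + 1})"
      using r by (intro integral_has_real_derivative continuous_on_subset[OF v_cont]) auto
    moreover have "at r within {0..} = at r within {0..r + 1}"
      by (rule at_within_nhd[of _ "{r - 1<..<r + 1}"]) auto
    ultimately have "((\<lambda>r. integral {0..r} v) has_real_derivative v r) (at r within {0..})" by simp
    from DERIV_diff[OF DERIV_const this] show ?thesis by (simp add: u_def[abs_def])
  qed
  have u_cont: "continuous_on {0..} u"
    using du by (auto intro!: DERIV_continuous_on)
  have v_cont': "continuous_on S v" for S using v_cont continuous_on_subset by blast
  have F_cont: "continuous_on {0..} F"
    unfolding continuous_on_def
  proof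
    fix x :: real assume x: "x \<in> {0..}"
    have "((\<lambda>s. C * (\<bar>u s - u x\<bar> + \<bar>v s - v x\<bar>)) \<longlongrightarrow> C * (\<bar>u x - u x\<bar> + \<bar>v x - v x\<bar>)) (at x within {0..})"
      using x u_cont v_cont'[of "{0..}"] by (intro tendsto_intros) (auto simp: continuous_on_def)
    then have lim: "((\<lambda>s. C * (\<bar>u s - u x\<bar> + \<bar>v s - v x\<bar>)) \<longlongrightarrow> 0) (at x within {0..})"
      by simp
    have "((\<lambda>s. F s - F x) \<longlongrightarrow> 0) (at x within {0..})"
      unfolding F_def
      by (rule Lim_null_comparison[OF _ lim]) (unfold real_norm_def, intro always_eventually allI lip)
    then show "(F \<longlongrightarrow> F x) (at x within {0..})" by (simp add: LIM_zero_iff)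
  qed
  define I where "I r = integral {0..r} (\<lambda>s. s ^ n * F s)" for r
  have dI: "(I has_real_derivative r ^ n * F r) (at r)" if "0 < r" for r
    unfolding I_def[abs_def] using that
    by (intro integral_real_derivative_open[of "\<lambda>s. s ^ n * F s"] continuous_intros F_cont)
  have v_I: "v r = I r / r ^ n" for r
    using v_eq[of r] by (simp add: I_def F_def u_def)
  have dv: "(v has_real_derivative F r - real n / r * v r) (at r)" if r: "0 < r" for r
  proof -
    have rn: "r ^ n = r * r ^ (n - 1)" using n by (simp add: power_eq_if)
    have "((\<lambda>r. I r / r ^ n) has_real_derivative
        (r ^ n * F r * r ^ n - I r * (real n * r ^ (n - 1))) / (r ^ n * r ^ n)) (at r)"
      by (rule derivative_eq_intros dI r refl)+ (use r in simp_all)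
    moreover have "(r ^ n * F r * r ^ n - I r * (real n * r ^ (n - 1))) / (r ^ n * r ^ n) = F r - real n / r * (I r / r ^ n)"
      using r unfolding rn by (simp add: field_simps)
    ultimately show ?thesis by (simp add: v_I[abs_def])
  qed
  have F_lim: "(F \<longlongrightarrow> f a 0) (at_right 0)"
    using F_cont F_0 by (force simp: continuous_on_def simp flip: at_within_Ici_at_right)
  have v_lim: "(v \<longlongrightarrow> 0) (at_right 0)"
    using v_cont'[of "{0..}"] v_0 by (force simp: continuous_on_def simp flip: at_within_Ici_at_right)
  have v_slope: "((\<lambda>r. v r / r) \<longlongrightarrow> f a 0 / real (Suc n)) (at_right 0)"
  proof -
    have ev0: "eventually (\<lambda>r. 0 < r) (at_right (0::real))" by (simp add: eventually_at_right_less)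
    \<comment> \<open>As \<open>v r / r\<close> is \<open>I r / r ^ Suc n\<close>, L'Hopital's rule
      reduces its limit to that of \<open>F r / real (Suc n)\<close>.\<close>
    have "((\<lambda>r. I r / r ^ Suc n) \<longlongrightarrow> f a 0 / real (Suc n)) (at_right 0)"
    proof (rule lhopital_right_0)
      have "((\<lambda>r. v r * r ^ n) \<longlongrightarrow> 0 * 0 ^ n) (at_right 0)"
        by (intro tendsto_intros v_lim)
      then have "((\<lambda>r. v r * r ^ n) \<longlongrightarrow> 0) (at_right 0)" by simp
      moreover have "eventually (\<lambda>r. v r * r ^ n = I r) (at_right 0)"
        using ev0 by eventually_elim (simp add: v_I)
      ultimately show "(I \<longlongrightarrow> 0) (at_right 0)" by (rule Lim_transform_eventually)
      have "((\<lambda>r::real. r ^ Suc n) \<longlongrightarrow> 0 ^ Suc n) (at_right 0)" by (intro tendsto_intros)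
      then show "((\<lambda>r::real. r ^ Suc n) \<longlongrightarrow> 0) (at_right 0)" by simp
      from ev0 show "eventually (\<lambda>r::real. r ^ Suc n \<noteq> 0) (at_right 0)" by eventually_elim simp
      from ev0 show "eventually (\<lambda>r. real (Suc n) * r ^ n \<noteq> 0) (at_right 0)"
        by eventually_elim simp
      from ev0 show "eventually (\<lambda>r. (I has_real_derivative r ^ n * F r) (at r)) (at_right 0)"
        by eventually_elim (rule dI)
      show "eventually (\<lambda>r. ((\<lambda>r. r ^ Suc n) has_real_derivative real (Suc n) * r ^ n) (at r)) (at_right 0)"
        by (intro always_eventually allI) (rule derivative_eq_intros refl | simp)+
      have "((\<lambda>r. F r / real (Suc n)) \<longlongrightarrow> f a 0 / real (Suc n)) (at_right 0)"
        by (intro tendsto_intros F_lim) simp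
      moreover have "eventually (\<lambda>r. F r / real (Suc n) = r ^ n * F r / (real (Suc n) * r ^ n)) (at_right 0)"
        using ev0 by eventually_elim simp
      ultimately show "((\<lambda>r. r ^ n * F r / (real (Suc n) * r ^ n)) \<longlongrightarrow> f a 0 / real (Suc n)) (at_right 0)"
        by (rule Lim_transform_eventually)
    qed
    moreover have "eventually (\<lambda>r. I r / r ^ Suc n = v r / r) (at_right 0)"
      using ev0
    proof eventually_elim
      case (elim r)
      then show ?case by (simp add: v_I mult.commute)
    qed
    ultimately show ?thesis by (rule Lim_transform_eventually)
  qed
  show ?thesis
    by (rule that[of u v, OF u_0 v_0 du _ v_slope v_cont']) (use dv F_cont in \<open>simp_all add: F_def[abs_def]\<close>)
qed

section \<open>The autonomous flow\<close>

locale supercritical =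
  fixes N :: nat and p m :: real
  assumes m_pos: "0 < m" and N_ge: "3 \<le> N"
    and p_ge: "(real N + 2) / (real N - 2) \<le> p"
begin

definition "\<alpha> = 2 / (p - 1)"
definition "q = 2 * p / (p + 1)"
definition "L = real N - 2 - 2 * \<alpha>"
text \<open>Equal to \<open>K_const N p\<close>, with the quotient divided out.\<close>

definition "K = real N - 2 - \<alpha>"

lemma p_gt_1: "1 < p"
proof -
  have "1 < (real N + 2) / (real N - 2)" using N_ge by (simp add: field_simps)
  then show ?thesis using p_ge by simp
qed

lemma \<alpha>_pos: "0 < \<alpha>"
  using p_gt_1 by (simp add: \<alpha>_def)

lemma q_gt_1: "1 < q" and q_lt_p: "q < p"
  using p_gt_1 by (simp_all add: q_def field_simps)

text \<open>Together with \<open>\<alpha>_q\<close>, this makes the power of \<open>u\<close> and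
  the gradient term scale with the same exponent \<open>\<alpha> + 2\<close> as the second
  derivative, so the transformed equation is free of \<open>t\<close>.\<close>

lemma \<alpha>_p: "\<alpha> * p = \<alpha> + 2"
  using p_gt_1 by (simp add: \<alpha>_def field_simps)

lemma \<alpha>_q: "(\<alpha> + 1) * q = \<alpha> + 2"
proof -
  have "\<alpha> + 1 = (p + 1) / (p - 1)" "\<alpha> + 2 = 2 * p / (p - 1)"
    using p_gt_1 by (simp_all add: \<alpha>_def field_simps)
  then show ?thesis using p_gt_1 by (simp add: q_def)
qed

lemma L_nonneg: "0 \<le> L"
proof -
  have "real N + 2 \<le> p * (real N - 2)"
    using p_ge N_ge by (simp add: field_simps)
  then have "4 \<le> (p - 1) * (real N - 2)"
    by (simp add: algebra_simps)
  then have "2 * \<alpha> \<le> real N - 2"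
    using p_gt_1 by (simp add: \<alpha>_def field_simps)
  then show ?thesis by (simp add: L_def)
qed

lemma K_pos: "0 < K"
  using L_nonneg \<alpha>_pos by (simp add: L_def K_def)

section \<open>Emden-Fowler variables and decay of the energy\<close>

definition flow :: "(real \<Rightarrow> real) \<Rightarrow> (real \<Rightarrow> real) \<Rightarrow> real \<Rightarrow> bool" where
  "flow x y t \<longleftrightarrow> (x has_real_derivative y t) (at t) \<and>
     (y has_real_derivative
        - L * y t + \<alpha> * K * x t - x t powr p + m * (\<alpha> * x t - y t) powr q) (at t)"

text \<open>Kinetic energy plus the potential of the force in which
  \<open>(\<alpha> * x - y) powr q\<close> is replaced by \<open>(\<alpha> * x) powr q\<close>,
  normalized to vanish at the origin.\<close>

definition energy :: "real \<Rightarrow> real \<Rightarrow> real" where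
  "energy x y = y\<^sup>2 / 2 - \<alpha> * K * x\<^sup>2 / 2 + x powr (p + 1) / (p + 1)
     - m * \<alpha> powr q * x powr (q + 1) / (q + 1)"

text \<open>The Emden-Fowler variable \<open>x\<close> of \<open>u\<close>, and \<open>y = x'\<close> when \<open>u1 = u'\<close>.\<close>

definition ef_x :: "(real \<Rightarrow> real) \<Rightarrow> real \<Rightarrow> real" where
  "ef_x u t = exp (\<alpha> * t) * u (exp t)"

definition ef_y :: "(real \<Rightarrow> real) \<Rightarrow> (real \<Rightarrow> real) \<Rightarrow> real \<Rightarrow> real" where
  "ef_y u u1 t = \<alpha> * ef_x u t + exp ((\<alpha> + 1) * t) * u1 (exp t)"

text \<open>Each term of the equation acquires the factor \<open>exp ((\<alpha> + 2) * t)\<close>.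
  The gradient enters through \<open>\<alpha> * ef_x u t - ef_y u u1 t\<close>, a positive multiple
  of \<open>- u1 (exp t)\<close>; the sign conditions let the powers be taken factor by
  factor.\<close>

lemma ef_flow:
  assumes u: "(u has_real_derivative u1 (exp t)) (at (exp t))"
    and u1: "(u1 has_real_derivative u2) (at (exp t))"
    and nonneg: "0 \<le> u (exp t)" "u1 (exp t) \<le> 0"
    and ode: "u2 + (real N - 1) / exp t * u1 (exp t) + u (exp t) powr p = m * (- u1 (exp t)) powr q"
  shows "flow (ef_x u) (ef_y u u1) t"
proof -
  define E where "E = exp ((\<alpha> + 2) * t)"
  have chain_u: "((\<lambda>t. u (exp t)) has_real_derivative u1 (exp t) * exp t) (at t)"
    by (rule DERIV_chain2[OF u DERIV_exp])
  have chain_u1: "((\<lambda>t. u1 (exp t)) has_real_derivative u2 * exp t) (at t)"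
    by (rule DERIV_chain2[OF u1 DERIV_exp])
  have x: "(ef_x u has_real_derivative ef_y u u1 t) (at t)"
    unfolding ef_x_def ef_y_def
    by (rule derivative_eq_intros chain_u refl)+ (simp add: algebra_simps exp_add)
  have y: "(ef_y u u1 has_real_derivative
      \<alpha> * ef_y u u1 t + ((\<alpha> + 1) * exp ((\<alpha> + 1) * t) * u1 (exp t) + exp ((\<alpha> + 1) * t) * (u2 * exp t))) (at t)"
    unfolding ef_y_def[of u u1 t for t, abs_def]
    by (rule derivative_eq_intros chain_u1 x refl)+ (simp add: ef_y_def algebra_simps)
  have xp: "ef_x u t powr p = E * u (exp t) powr p"
  proof -
    have "\<alpha> * t * p = (\<alpha> + 2) * t" unfolding \<alpha>_p[symmetric] by simp
    then show ?thesis using nonneg by (simp add: ef_x_def E_def powr_mult exp_powr_real)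
  qed
  have "\<alpha> * ef_x u t - ef_y u u1 t = exp ((\<alpha> + 1) * t) * (- u1 (exp t))"
    by (simp add: ef_y_def)
  then have wq: "(\<alpha> * ef_x u t - ef_y u u1 t) powr q = E * (- u1 (exp t)) powr q"
  proof -
    have e: "exp ((\<alpha> + 1) * t) powr q = E"
    proof -
      have "(\<alpha> + 1) * t * q = (\<alpha> + 2) * t" unfolding \<alpha>_q[symmetric] by simp
      then show ?thesis by (simp only: exp_powr_real E_def)
    qed
    show ?thesis
      unfolding \<open>\<alpha> * ef_x u t - ef_y u u1 t = _\<close> by (subst powr_mult) (use nonneg e in simp_all)
  qed
  have e1: "exp ((\<alpha> + 1) * t) * exp t = E"
    by (simp add: E_def algebra_simps flip: exp_add)
  have e2: "exp ((\<alpha> + 1) * t) = E / exp t"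
    by (simp add: e1[symmetric])
  have "exp ((\<alpha> + 1) * t) * (u2 * exp t) = E * u2"
    by (simp add: e1[symmetric])
  also have "\<dots> = E * (m * (- u1 (exp t)) powr q - u (exp t) powr p - (real N - 1) / exp t * u1 (exp t))"
    by (rule arg_cong[of _ _ "(*) E"]) (use ode in linarith)
  also have "\<dots> = m * (\<alpha> * ef_x u t - ef_y u u1 t) powr q - ef_x u t powr p - (real N - 1) * (exp ((\<alpha> + 1) * t) * u1 (exp t))"
    by (simp only: xp wq e2) (simp add: field_simps)
  finally have *: "exp ((\<alpha> + 1) * t) * (u2 * exp t) = \<dots>" .
  have "\<alpha> * ef_y u u1 t + ((\<alpha> + 1) * exp ((\<alpha> + 1) * t) * u1 (exp t) + exp ((\<alpha> + 1) * t) * (u2 * exp t))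
     = - L * ef_y u u1 t + \<alpha> * K * ef_x u t - ef_x u t powr p + m * (\<alpha> * ef_x u t - ef_y u u1 t) powr q"
    unfolding * by (simp add: ef_y_def L_def K_def algebra_simps)
  with x y show ?thesis by (simp add: flow_def)
qed

text \<open>\<open>ef_y u u1 t\<close> is \<open>exp (\<alpha> * t)\<close> times
  \<open>\<alpha> * u (exp t) + exp t * u1 (exp t)\<close>, and the latter tends to
  \<open>\<alpha> * u0\<close>. Thus a regular solution leaves the origin of the phase plane with
  positive velocity.\<close>

lemma ef_at_bot:
  assumes u: "(u \<longlongrightarrow> u0) (at_right 0)" and u1: "(u1 \<longlongrightarrow> 0) (at_right 0)" and u0: "0 < u0"
  shows "(ef_x u \<longlongrightarrow> 0) at_bot" "(ef_y u u1 \<longlongrightarrow> 0) at_bot" "eventually (\<lambda>t. 0 < ef_y u u1 t) at_bot"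
proof -
  have ex: "filterlim exp (at_right (0::real)) at_bot"
    by (auto simp: filterlim_at exp_at_bot)
  have e: "((\<lambda>t. exp (c * t)) \<longlongrightarrow> 0) at_bot" if "0 < c" for c :: real
    by (rule filterlim_compose[OF exp_at_bot])
      (use that in \<open>simp add: filterlim_tendsto_pos_mult_at_bot[OF tendsto_const _ filterlim_ident]\<close>)
  note cu = filterlim_compose[OF u ex] and cu1 = filterlim_compose[OF u1 ex]
  have x: "((\<lambda>t. ef_x u t) \<longlongrightarrow> 0 * u0) at_bot"
    unfolding ef_x_def using \<alpha>_pos by (intro tendsto_mult e cu)
  then show "(ef_x u \<longlongrightarrow> 0) at_bot" by simp
  have "((\<lambda>t. ef_y u u1 t) \<longlongrightarrow> \<alpha> * (0 * u0) + 0 * 0) at_bot"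
    unfolding ef_y_def using \<alpha>_pos by (intro tendsto_add tendsto_mult tendsto_const x e cu1) auto
  then show "(ef_y u u1 \<longlongrightarrow> 0) at_bot" by simp
  have "((\<lambda>t. \<alpha> * u (exp t) + exp t * u1 (exp t)) \<longlongrightarrow> \<alpha> * u0 + 0 * 0) at_bot"
    by (intro tendsto_intros cu cu1 exp_at_bot)
  then have "eventually (\<lambda>t. 0 < \<alpha> * u (exp t) + exp t * u1 (exp t)) at_bot"
    by (rule order_tendstoD(1)) (use \<alpha>_pos u0 in simp)
  then show "eventually (\<lambda>t. 0 < ef_y u u1 t) at_bot"
  proof eventually_elim
    case (elim t)
    have "ef_y u u1 t = exp (\<alpha> * t) * (\<alpha> * u (exp t) + exp t * u1 (exp t))"
      by (simp add: ef_y_def ef_x_def algebra_simps exp_add)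
    then show ?case using elim by simp
  qed
qed

lemma energy_decay:
  assumes flow: "flow x y t" and x: "0 < x t" and w: "y t \<le> \<alpha> * x t"
  obtains D where "((\<lambda>t. energy (x t) (y t)) has_real_derivative D) (at t)"
    "D \<le> - (m * (\<alpha> * x t) powr (q - 1) * (y t)\<^sup>2)"
proof -
  define A where "A = \<alpha> * x t"
  have A: "0 < A" using x \<alpha>_pos by (simp add: A_def)
  note dx = conjunct1[OF flow[unfolded flow_def]] and dy = conjunct2[OF flow[unfolded flow_def]]
  have dxp: "((\<lambda>t. x t powr c) has_real_derivative c * x t powr (c - 1) * y t) (at t)" for c
    by (rule DERIV_chain2[OF has_real_derivative_powr[OF x] dx])
  let ?Y = "- L * y t + \<alpha> * K * x t - x t powr p + m * (\<alpha> * x t - y t) powr q"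
  have dy2: "((\<lambda>t. (y t)\<^sup>2 / 2) has_real_derivative y t * ?Y) (at t)"
    by (rule derivative_eq_intros dy refl | simp)+
  have dx2: "((\<lambda>t. \<alpha> * K * (x t)\<^sup>2 / 2) has_real_derivative \<alpha> * K * x t * y t) (at t)"
    by (rule derivative_eq_intros dx refl | simp)+
  have dp: "((\<lambda>t. x t powr (p + 1) / (p + 1)) has_real_derivative x t powr p * y t) (at t)"
    using DERIV_cdivide[OF dxp[of "p + 1"], of "p + 1"] p_gt_1 by simp
  have dq: "((\<lambda>t. m * \<alpha> powr q * x t powr (q + 1) / (q + 1)) has_real_derivative m * \<alpha> powr q * x t powr q * y t) (at t)"
    using DERIV_cmult[OF DERIV_cdivide[OF dxp[of "q + 1"], of "q + 1"], of "m * \<alpha> powr q"] q_gt_1 by (simp add: mult.assoc)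
  have "((\<lambda>t. energy (x t) (y t)) has_real_derivative
      y t * (- L * y t + \<alpha> * K * x t - x t powr p + m * (\<alpha> * x t - y t) powr q)
      - \<alpha> * K * x t * y t + x t powr p * y t - m * \<alpha> powr q * x t powr q * y t) (at t)"
    unfolding energy_def
    by (intro DERIV_add DERIV_diff dy2 dx2 dp dq)
  moreover have "y t * (- L * y t + \<alpha> * K * x t - x t powr p + m * (\<alpha> * x t - y t) powr q)
      - \<alpha> * K * x t * y t + x t powr p * y t - m * \<alpha> powr q * x t powr q * y t
      = - L * (y t)\<^sup>2 - m * ((A - (A - y t)) * (A powr q - (A - y t) powr q))"
    using x \<alpha>_pos by (simp add: A_def powr_mult algebra_simps power2_eq_square)
  moreover have "\<dots> \<le> - (m * A powr (q - 1) * (y t)\<^sup>2)"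
  proof -
    have "A powr (q - 1) * (A - (A - y t))\<^sup>2 \<le> (A - (A - y t)) * (A powr q - (A - y t) powr q)"
      using A w q_gt_1 by (intro powr_chord) (auto simp: A_def)
    then have "m * (A powr (q - 1) * (A - (A - y t))\<^sup>2) \<le> m * ((A - (A - y t)) * (A powr q - (A - y t) powr q))"
      using m_pos by (intro mult_left_mono) auto
    moreover have "0 \<le> L * (y t)\<^sup>2" using L_nonneg by simp
    ultimately show ?thesis by (simp add: algebra_simps)
  qed
  ultimately show ?thesis using that by (simp add: A_def)
qed

lemma energy_tendsto:
  assumes "(x \<longlongrightarrow> a) F" "(y \<longlongrightarrow> b) F" "eventually (\<lambda>t. 0 \<le> x t) F"
  shows "((\<lambda>t. energy (x t) (y t)) \<longlongrightarrow> energy a b) F"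
  unfolding energy_def using assms p_gt_1 q_gt_1 by (intro tendsto_intros) auto

lemma energy_antimono:
  assumes flow: "\<And>\<tau>. s \<le> \<tau> \<Longrightarrow> \<tau> \<le> t \<Longrightarrow> flow x y \<tau> \<and> 0 < x \<tau> \<and> y \<tau> \<le> \<alpha> * x \<tau>"
    and le: "s \<le> t"
  shows "energy (x t) (y t) \<le> energy (x s) (y s)"
proof (rule DERIV_nonpos_imp_nonincreasing[OF le])
  fix \<tau> assume \<tau>: "s \<le> \<tau>" "\<tau> \<le> t"
  obtain D where D: "((\<lambda>t. energy (x t) (y t)) has_real_derivative D) (at \<tau>)"
    "D \<le> - (m * (\<alpha> * x \<tau>) powr (q - 1) * (y \<tau>)\<^sup>2)"
    using energy_decay flow[OF \<tau>] by metis
  moreover have "0 \<le> m * (\<alpha> * x \<tau>) powr (q - 1) * (y \<tau>)\<^sup>2" using m_pos by simp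
  ultimately show "\<exists>D. ((\<lambda>t. energy (x t) (y t)) has_real_derivative D) (at \<tau>) \<and> D \<le> 0"
    by force
qed

text \<open>The energy starts from 0 at minus infinity and does not increase, so it is nonpositive;
  it drops strictly while \<open>y\<close> is positive, hence stays below a negative constant
  afterwards. \<open>S\<close> is the whole line for a global solution and a left half-line before a
  hypothetical zero of \<open>u\<close>.\<close>

lemma energy_negative:
  assumes down: "\<And>s t. t \<in> S \<Longrightarrow> s \<le> t \<Longrightarrow> s \<in> S" and ne: "S \<noteq> {}"
    and flow: "\<And>t. t \<in> S \<Longrightarrow> flow x y t \<and> 0 < x t \<and> y t \<le> \<alpha> * x t"
    and lim: "(x \<longlongrightarrow> 0) at_bot" "(y \<longlongrightarrow> 0) at_bot" and y: "eventually (\<lambda>t. 0 < y t) at_bot"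
  obtains t0 c where "t0 \<in> S" "0 < c" "\<And>t. t \<in> S \<Longrightarrow> t0 \<le> t \<Longrightarrow> energy (x t) (y t) \<le> - c"
proof -
  let ?F = "\<lambda>t. energy (x t) (y t)"
  obtain T where T: "T \<in> S" using ne by blast
  have evS: "eventually (\<lambda>t. t \<in> S) at_bot"
    using down[OF T] by (auto simp: eventually_at_bot_linorder)
  have F_lim: "(?F \<longlongrightarrow> 0) at_bot"
  proof -
    have "eventually (\<lambda>t. 0 \<le> x t) at_bot"
      using evS by eventually_elim (use flow in force)
    from energy_tendsto[OF lim this] show ?thesis
      by (simp add: energy_def)
  qed
  have F_le: "?F t \<le> ?F s" if "t \<in> S" "s \<le> t" for s t
    using that flow down by (intro energy_antimono) blast+
  have F_nonpos: "?F t \<le> 0" if "t \<in> S" for t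
  proof (rule tendsto_lowerbound[OF F_lim])
    show "eventually (\<lambda>s. ?F t \<le> ?F s) at_bot"
      using F_le[OF that] by (auto simp: eventually_at_bot_linorder)
  qed simp
  obtain t1 where t1: "t1 \<in> S" "\<And>t. t \<le> t1 \<Longrightarrow> 0 < y t"
  proof -
    have "eventually (\<lambda>t. t \<in> S \<and> 0 < y t) at_bot" using evS y by eventually_elim auto
    then show ?thesis using that by (auto simp: eventually_at_bot_linorder)
  qed
  have neg: "?F t1 < ?F (t1 - 1)"
  proof (rule DERIV_neg_imp_decreasing[of "t1 - 1" t1 ?F])
    fix t assume t: "t1 - 1 \<le> t" "t \<le> t1"
    then have tS: "t \<in> S" using down t1 by blast
    obtain D where D: "(?F has_real_derivative D) (at t)"
      "D \<le> - (m * (\<alpha> * x t) powr (q - 1) * (y t)\<^sup>2)"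
      using energy_decay flow[OF tS] by metis
    moreover have "0 < m * (\<alpha> * x t) powr (q - 1) * (y t)\<^sup>2"
      using m_pos \<alpha>_pos flow[OF tS] t1(2)[of t] t by (intro mult_pos_pos) auto
    ultimately show "\<exists>D. (?F has_real_derivative D) (at t) \<and> D < 0" by force
  qed simp
  have "t1 - 1 \<in> S" using down t1(1) by simp
  then have "?F t1 < 0" using neg F_nonpos[of "t1 - 1"] by simp
  then show ?thesis
    using that[of t1 "- ?F t1"] t1 F_le by simp
qed

text \<open>Up to the factor \<open>x powr q\<close>, this is the force at a rest point; its zero is the constant
  solution of the autonomous equation.\<close>

definition balance :: "real \<Rightarrow> real" where
  "balance x = x powr (p - q) - m * \<alpha> powr q - \<alpha> * K * x powr (1 - q)"

lemma balance_force:
  "0 < x \<Longrightarrow> x powr q * balance x = x powr p - m * \<alpha> powr q * x powr q - \<alpha> * K * x"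
  by (simp add: balance_def right_diff_distrib mult.left_commute powr_add[symmetric])

text \<open>The left side is the one in the equation defining \<open>X_M\<close>. The factor
  \<open>x powr (q - 1)\<close> is positive, so both forms have the same positive roots, while only
  \<open>balance\<close> is visibly monotone.\<close>

lemma balance_equation:
  assumes "0 < x"
  shows "x powr (p - 1) - m * \<alpha> powr q * x powr (q - 1) - \<alpha> * K = x powr (q - 1) * balance x"
  using assms by (simp add: balance_def right_diff_distrib mult.left_commute powr_add[symmetric])

text \<open>Since \<open>1 < q < p\<close>, the first power has a positive exponent and the
  subtracted one a negative exponent. Uniqueness of the rest point follows.\<close>

lemma balance_strict_mono: "0 < x \<Longrightarrow> x < y \<Longrightarrow> balance x < balance y"
proof -
  assume xy: "0 < x" "x < y"
  have "x powr (p - q) < y powr (p - q)"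
    using xy q_lt_p by (intro powr_less_mono2) auto
  moreover have "y powr (1 - q) \<le> x powr (1 - q)"
    using xy q_gt_1 by (intro powr_mono2') auto
  then have "\<alpha> * K * y powr (1 - q) \<le> \<alpha> * K * x powr (1 - q)"
    using \<alpha>_pos K_pos by (intro mult_left_mono) auto
  ultimately show ?thesis by (simp add: balance_def)
qed

lemma balance_root: "\<exists>X>0. balance X = 0"
proof -
  define B where "B = m * \<alpha> powr q"
  \<comment> \<open>The intermediate value theorem is applied to this form, which is continuous up
    to 0 and equals \<open>- \<alpha> * K\<close> there.\<close>
  define e where "e x = x powr (p - 1) - B * x powr (q - 1) - \<alpha> * K" for x
  \<comment> \<open>Chosen so that \<open>b powr (p - q)\<close> outweighs both negative terms of
    \<open>balance b\<close>; \<open>b\<close> is at least 1, so its negative power is at most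
    1.\<close>
  define b where "b = (1 + B + \<alpha> * K) powr (1 / (p - q))"
  have B: "0 \<le> B" and aK: "0 < \<alpha> * K" using m_pos \<alpha>_pos K_pos by (auto simp: B_def)
  have b1: "1 \<le> b" using q_lt_p B aK by (auto simp: b_def intro!: ge_one_powr_ge_zero)
  have bpq: "b powr (p - q) = 1 + B + \<alpha> * K"
    using q_lt_p B aK by (simp add: b_def powr_powr)
  have "b powr (1 - q) \<le> b powr 0" using b1 q_gt_1 by (intro powr_mono) auto
  then have "b powr (1 - q) \<le> 1" using b1 by simp
  then have "\<alpha> * K * b powr (1 - q) \<le> \<alpha> * K" using aK by (simp add: mult_left_le)
  then have "0 \<le> balance b" by (simp add: balance_def bpq B_def[symmetric])
  then have eb: "0 \<le> e b"
    using balance_equation[of b] b1 by (simp add: e_def B_def)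
  have e0: "e 0 \<le> 0" using aK by (simp add: e_def)
  have "continuous_on {0..b} e"
    unfolding e_def using p_gt_1 q_gt_1 by (intro continuous_intros continuous_on_powr') auto
  then obtain X where X: "0 \<le> X" "X \<le> b" "e X = 0"
    using IVT'[of e 0 0 b] e0 eb b1 by auto
  have "X \<noteq> 0" using X aK by (auto simp: e_def)
  then have "X powr (q - 1) * balance X = 0"
    using balance_equation[of X] X by (simp add: e_def B_def)
  then show ?thesis using X \<open>X \<noteq> 0\<close> by (intro exI[of _ X]) auto
qed

section \<open>Confinement and convergence of trajectories\<close>

text \<open>The potential tends to 0 at \<open>x = 0\<close> and to infinity for large
  \<open>x\<close>, so a level below 0 excludes both ends; bounded \<open>x\<close> then bounds the
  kinetic part.\<close>

lemma negative_energy_bounds: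
  assumes c: "0 < c"
  obtains a b Y where "0 < a" "0 < Y" "0 < b"
    "\<And>x y. 0 < x \<Longrightarrow> energy x y \<le> - c \<Longrightarrow> a \<le> x \<and> x \<le> b \<and> \<bar>y\<bar> \<le> Y"
proof -
  define E where "E = m * \<alpha> powr q / (q + 1)"
  \<comment> \<open>The negative terms of the energy sum to at most
    \<open>D * x powr (q + 1)\<close> in size for \<open>x\<close> above 1 and \<open>D * x\<close>
    below 1, which yields \<open>b\<close> and \<open>a\<close>; \<open>W\<close> bounds them for
    all \<open>x\<close> up to \<open>b\<close>.\<close>
  define D where "D = \<alpha> * K / 2 + E"
  define a where "a = min 1 (c / D)"
  define b where "b = max 1 ((D * (p + 1)) powr (1 / (p - q)))"
  define W where "W = \<alpha> * K * b\<^sup>2 / 2 + E * b powr (q + 1)"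
  have E: "0 < E" using m_pos \<alpha>_pos q_gt_1 by (simp add: E_def)
  have D: "0 < D" using E \<alpha>_pos K_pos unfolding D_def by (intro add_pos_pos) simp_all
  have b: "1 \<le> b" by (simp add: b_def)
  have W: "0 < W" using E \<alpha>_pos K_pos b unfolding W_def by (intro add_pos_pos) simp_all
  have main: "a \<le> x \<and> x \<le> b \<and> \<bar>y\<bar> \<le> sqrt (2 * W)" if x: "0 < x" and en: "energy x y \<le> - c" for x y
  proof -
    have le: "y\<^sup>2 / 2 + x powr (p + 1) / (p + 1) + c \<le> \<alpha> * K * x\<^sup>2 / 2 + E * x powr (q + 1)"
      using en by (simp add: energy_def E_def)
    have xp: "0 \<le> x powr (p + 1) / (p + 1)" using p_gt_1 by simp
    have y2: "0 \<le> y\<^sup>2 / 2" by simp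
    have x2: "x\<^sup>2 = x powr 2" using x by (simp add: powr_numeral)
    have "x \<le> b"
    proof (cases "1 \<le> x")
      case True
      have "x\<^sup>2 \<le> x powr (q + 1)" unfolding x2 using True q_gt_1 by (intro powr_mono) auto
      then have "\<alpha> * K * x\<^sup>2 \<le> \<alpha> * K * x powr (q + 1)"
        using \<alpha>_pos K_pos by (intro mult_left_mono) auto
      then have "x powr (p + 1) / (p + 1) \<le> D * x powr (q + 1)"
        using le c y2 unfolding D_def distrib_right times_divide_eq_left by linarith
      moreover have "x powr (p + 1) = x powr (p - q) * x powr (q + 1)"
        by (simp add: powr_add[symmetric])
      ultimately have "x powr (q + 1) * x powr (p - q) \<le> x powr (q + 1) * (D * (p + 1))"
        using p_gt_1 by (simp add: field_simps)
      then have "x powr (p - q) \<le> D * (p + 1)"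
        using x by (simp add: mult_le_cancel_left_pos)
      then have "(x powr (p - q)) powr (1 / (p - q)) \<le> (D * (p + 1)) powr (1 / (p - q))"
        using q_lt_p by (intro powr_mono2) auto
      then show ?thesis using q_lt_p x by (simp add: powr_powr b_def)
    qed (use b in simp)
    moreover have "a \<le> x"
    proof (cases "1 \<le> x")
      case False
      have "x\<^sup>2 \<le> x" using x False by (simp add: power2_eq_square mult_left_le)
      then have "\<alpha> * K * x\<^sup>2 \<le> \<alpha> * K * x"
        using \<alpha>_pos K_pos by (intro mult_left_mono) auto
      moreover have "x powr (q + 1) \<le> x powr 1"
        using x False q_gt_1 by (intro powr_mono') auto
      then have "E * x powr (q + 1) \<le> E * x" using E x by simp
      ultimately have "c \<le> D * x"
        using le xp y2 unfolding D_def distrib_right times_divide_eq_left by linarith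
      then have "c / D \<le> x" using D by (simp add: field_simps)
      then show ?thesis by (simp add: a_def)
    qed (simp add: a_def)
    moreover have "\<bar>y\<bar> \<le> sqrt (2 * W)"
    proof -
      have "\<alpha> * K * x\<^sup>2 \<le> \<alpha> * K * b\<^sup>2"
        using \<alpha>_pos K_pos x \<open>x \<le> b\<close> by (intro mult_left_mono power_mono) auto
      moreover have "E * x powr (q + 1) \<le> E * b powr (q + 1)"
        using E q_gt_1 x \<open>x \<le> b\<close> by (intro mult_left_mono powr_mono2) auto
      ultimately have "y\<^sup>2 \<le> 2 * W" using le xp c by (simp add: W_def)
      then show ?thesis using real_le_rsqrt[of "\<bar>y\<bar>"] by simp
    qed
    ultimately show ?thesis by simp
  qed
  show ?thesis
    by (rule that[of a "sqrt (2 * W)" b]) (use main c D b W in \<open>auto simp: a_def\<close>)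
qed

text \<open>Confinement bounds \<open>y'\<close>, so \<open>dissipation_tendsto_zero\<close> sends
  \<open>y\<close> to 0. Then \<open>slope_tendsto_zero\<close>, applied to the equation for
  \<open>y\<close>, makes the force at \<open>x\<close> vanish in the limit, and monotonicity of
  \<open>balance\<close> locates the limit of \<open>x\<close>.\<close>

lemma trajectory_converges:
  assumes flow: "\<And>t. t0 \<le> t \<Longrightarrow> flow x y t \<and> 0 < x t \<and> y t \<le> \<alpha> * x t"
    and en: "\<And>t. t0 \<le> t \<Longrightarrow> energy (x t) (y t) \<le> - c" and c: "0 < c"
    and X: "0 < X" "balance X = 0"
  shows "(x \<longlongrightarrow> X) at_top"
proof -
  obtain a b Y where pos: "0 < a" "0 < Y" "0 < b"
    and bnd: "\<And>x y. 0 < x \<Longrightarrow> energy x y \<le> - c \<Longrightarrow> a \<le> x \<and> x \<le> b \<and> \<bar>y\<bar> \<le> Y"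
    using negative_energy_bounds[OF c] by metis
  have xy: "a \<le> x t" "x t \<le> b" "\<bar>y t\<bar> \<le> Y" if "t0 \<le> t" for t
    using bnd[of "x t" "y t"] flow[OF that] en[OF that] by auto
  define y' where "y' t = - L * y t + \<alpha> * K * x t - x t powr p + m * (\<alpha> * x t - y t) powr q" for t
  have dx: "(x has_real_derivative y t) (at t)" and dy: "(y has_real_derivative y' t) (at t)"
    if "t0 \<le> t" for t
    using flow[OF that] by (auto simp: flow_def y'_def)
  \<comment> \<open>\<open>R\<close> bounds both bases of the gradient powers, actual and frozen;
    \<open>Z\<close> below bounds the acceleration.\<close>
  define R where "R = \<alpha> * b + Y"
  define Z where "Z = L * Y + \<alpha> * K * b + b powr p + m * R powr q"
  have Z: "0 < Z"
    using L_nonneg pos \<alpha>_pos K_pos m_pos unfolding Z_def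
    by (intro add_pos_nonneg add_nonneg_pos mult_pos_pos mult_nonneg_nonneg) auto
  have w: "0 \<le> \<alpha> * x t - y t" "\<alpha> * x t - y t \<le> R" "\<alpha> * x t \<le> R" "0 \<le> \<alpha> * x t" if "t0 \<le> t" for t
  proof -
    have "\<alpha> * x t \<le> \<alpha> * b" using xy[OF that] \<alpha>_pos by simp
    then show "\<alpha> * x t - y t \<le> R" "\<alpha> * x t \<le> R"
      using xy(3)[OF that] pos by (auto simp: R_def)
  qed (use flow[OF that] \<alpha>_pos in auto)
  have y'_bound: "\<bar>y' t\<bar> \<le> Z" if t: "t0 \<le> t" for t
  proof -
    have 1: "\<bar>L * y t\<bar> \<le> L * Y" using L_nonneg xy(3)[OF t] by (simp add: abs_mult mult_left_mono)
    have 2: "0 \<le> \<alpha> * K * x t" "\<alpha> * K * x t \<le> \<alpha> * K * b"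
      using \<alpha>_pos K_pos xy(2)[OF t] flow[OF t] by auto
    have 3: "x t powr p \<le> b powr p" using p_gt_1 xy(2)[OF t] flow[OF t] by (intro powr_mono2) auto
    have "(\<alpha> * x t - y t) powr q \<le> R powr q" using q_gt_1 w[OF t] by (intro powr_mono2) auto
    then have 4: "m * (\<alpha> * x t - y t) powr q \<le> m * R powr q" using m_pos by simp
    have 5: "0 \<le> m * (\<alpha> * x t - y t) powr q" using m_pos by simp
    have 6: "0 \<le> x t powr p" by simp
    from 1 2 3 4 5 6 show ?thesis unfolding y'_def Z_def by linarith
  qed
  \<comment> \<open>A lower bound for the dissipation coefficient that is uniform in time because
    \<open>x\<close> stays above \<open>a\<close>.\<close>
  define k where "k = m * (\<alpha> * a) powr (q - 1)"
  have k: "0 < k" using m_pos \<alpha>_pos pos by (simp add: k_def)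
  let ?F = "\<lambda>t. energy (x t) (y t)"
  have "((\<lambda>t. k * (y t)\<^sup>2) \<longlongrightarrow> 0) at_top"
  proof (rule dissipation_tendsto_zero)
    have decay: "(?F has_real_derivative deriv ?F t) (at t)"
      "deriv ?F t \<le> - (m * (\<alpha> * x t) powr (q - 1) * (y t)\<^sup>2)" if t: "t0 \<le> t" for t
    proof -
      obtain D where D: "(?F has_real_derivative D) (at t)"
        "D \<le> - (m * (\<alpha> * x t) powr (q - 1) * (y t)\<^sup>2)"
        using energy_decay[of x y t] flow[OF t] by blast
      with DERIV_imp_deriv[OF D(1)] show "(?F has_real_derivative deriv ?F t) (at t)"
        "deriv ?F t \<le> - (m * (\<alpha> * x t) powr (q - 1) * (y t)\<^sup>2)" by simp_all
    qed
    show "(?F has_real_derivative deriv ?F t) (at t)" if "t0 \<le> t" for t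
      by (rule decay(1)[OF that])
    show "deriv ?F t \<le> - (k * (y t)\<^sup>2)" if t: "t0 \<le> t" for t
    proof -
      have "deriv ?F t \<le> - (m * (\<alpha> * x t) powr (q - 1) * (y t)\<^sup>2)"
        by (rule decay(2)[OF t])
      moreover have "(\<alpha> * a) powr (q - 1) \<le> (\<alpha> * x t) powr (q - 1)"
        using \<alpha>_pos pos q_gt_1 xy(1)[OF t] by (intro powr_mono2) auto
      then have "k * (y t)\<^sup>2 \<le> m * (\<alpha> * x t) powr (q - 1) * (y t)\<^sup>2"
        unfolding k_def using m_pos by (intro mult_right_mono mult_left_mono) auto
      ultimately show ?thesis by linarith
    qed
    show "0 \<le> k * (y t)\<^sup>2" for t using k by simp
    show "\<bar>k * (y t)\<^sup>2 - k * (y s)\<^sup>2\<bar> \<le> (2 * k * Y * Z) * (t - s)" if "t0 \<le> s" "s \<le> t" for s t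
    proof (rule lipschitz_from_derivative[OF _ _ that, of "\<lambda>t. k * (y t)\<^sup>2" "\<lambda>t. 2 * k * y t * y' t"])
      show "((\<lambda>t. k * (y t)\<^sup>2) has_real_derivative 2 * k * y t * y' t) (at t)" if "t0 \<le> t" for t
        by (rule derivative_eq_intros dy that refl | simp)+
      show "\<bar>2 * k * y t * y' t\<bar> \<le> 2 * k * Y * Z" if "t0 \<le> t" for t
        using k xy(3)[OF that] y'_bound[OF that] pos by (simp add: abs_mult mult_mono)
    qed
    show "0 < 2 * k * Y * Z" using k pos Z by simp
    show "- (\<alpha> * K * b\<^sup>2 / 2) - m * \<alpha> powr q * b powr (q + 1) / (q + 1) \<le> energy (x t) (y t)"
      if t: "t0 \<le> t" for t
    proof -
      have "\<alpha> * K * (x t)\<^sup>2 \<le> \<alpha> * K * b\<^sup>2"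
        using \<alpha>_pos K_pos flow[OF t] xy(2)[OF t] by (intro mult_left_mono power_mono) auto
      moreover have "m * \<alpha> powr q * x t powr (q + 1) / (q + 1) \<le> m * \<alpha> powr q * b powr (q + 1) / (q + 1)"
        using m_pos q_gt_1 flow[OF t] xy(2)[OF t]
        by (intro divide_right_mono mult_left_mono powr_mono2) auto
      moreover have "0 \<le> x t powr (p + 1) / (p + 1)" using p_gt_1 by simp
      moreover have "0 \<le> (y t)\<^sup>2" by simp
      ultimately show ?thesis unfolding energy_def by linarith
    qed
  qed
  then have "((\<lambda>t. k * (y t)\<^sup>2 / k) \<longlongrightarrow> 0 / k) at_top"
    using k by (intro tendsto_divide tendsto_const) auto
  then have y_lim: "(y \<longlongrightarrow> 0) at_top"
    using k by (simp add: tendsto_null_power)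
  \<comment> \<open>The acceleration is \<open>\<epsilon> t - G t\<close>: \<open>G\<close> is minus
    the force at rest, and \<open>\<epsilon>\<close> collects the terms that vanish with
    \<open>y\<close>.\<close>
  define G where "G t = x t powr p - m * \<alpha> powr q * x t powr q - \<alpha> * K * x t" for t
  define \<epsilon> where "\<epsilon> t = - L * y t + m * ((\<alpha> * x t - y t) powr q - (\<alpha> * x t) powr q)" for t
  define Cp where "Cp = p * b powr (p - 1) + m * \<alpha> powr q * (q * b powr (q - 1)) + \<alpha> * K"
  have Cp: "0 < Cp"
    unfolding Cp_def using p_gt_1 q_gt_1 pos m_pos \<alpha>_pos K_pos by (intro add_pos_pos mult_pos_pos) auto
  have G_lim: "(G \<longlongrightarrow> 0) at_top"
  proof (rule slope_tendsto_zero)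
    show "(y has_real_derivative \<epsilon> t - G t) (at t)" if t: "t0 \<le> t" for t
    proof -
      have "y' t = \<epsilon> t - G t"
        using \<alpha>_pos flow[OF t] by (simp add: y'_def \<epsilon>_def G_def powr_mult algebra_simps)
      then show ?thesis using dy[OF t] by simp
    qed
    show "\<bar>G t - G s\<bar> \<le> (Cp * Y) * (t - s)" if st: "t0 \<le> s" "s \<le> t" for s t
    proof -
      have t: "t0 \<le> t" using st by simp
      note xs = xy[OF st(1)] and xt = xy[OF t]
      have 1: "\<bar>x t powr p - x s powr p\<bar> \<le> p * b powr (p - 1) * \<bar>x t - x s\<bar>"
        using xs xt pos p_gt_1 by (intro powr_lipschitz) auto
      have "\<bar>x t powr q - x s powr q\<bar> \<le> q * b powr (q - 1) * \<bar>x t - x s\<bar>"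
        using xs xt pos q_gt_1 by (intro powr_lipschitz) auto
      then have "m * \<alpha> powr q * \<bar>x t powr q - x s powr q\<bar> \<le> m * \<alpha> powr q * (q * b powr (q - 1) * \<bar>x t - x s\<bar>)"
        using m_pos by (intro mult_left_mono) auto
      then have 2: "\<bar>m * \<alpha> powr q * (x t powr q - x s powr q)\<bar> \<le> m * \<alpha> powr q * (q * b powr (q - 1)) * \<bar>x t - x s\<bar>"
        using m_pos by (simp add: abs_mult mult.assoc)
      have 3: "\<bar>\<alpha> * K * (x t - x s)\<bar> = \<alpha> * K * \<bar>x t - x s\<bar>"
        using \<alpha>_pos K_pos by (simp add: abs_mult)
      have "G t - G s = (x t powr p - x s powr p) - m * \<alpha> powr q * (x t powr q - x s powr q) - \<alpha> * K * (x t - x s)"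
        by (simp add: G_def algebra_simps)
      then have "\<bar>G t - G s\<bar> \<le> p * b powr (p - 1) * \<bar>x t - x s\<bar>
          + m * \<alpha> powr q * (q * b powr (q - 1)) * \<bar>x t - x s\<bar> + \<alpha> * K * \<bar>x t - x s\<bar>"
        using 1 2 3 by linarith
      also have "\<dots> = Cp * \<bar>x t - x s\<bar>" by (simp add: Cp_def distrib_right)
      also have "\<dots> \<le> Cp * (Y * (t - s))"
        using lipschitz_from_derivative[OF dx xy(3) st] Cp by (intro mult_left_mono) auto
      finally show ?thesis by (simp add: mult.assoc)
    qed
    show "0 < Cp * Y" using Cp pos by simp
    show "(y \<longlongrightarrow> 0) at_top" by fact
    have "((\<lambda>t. (L + m * (q * R powr (q - 1))) * \<bar>y t\<bar>) \<longlongrightarrow> (L + m * (q * R powr (q - 1))) * \<bar>0\<bar>) at_top"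
      by (intro tendsto_intros y_lim)
    then have lim: "((\<lambda>t. (L + m * (q * R powr (q - 1))) * \<bar>y t\<bar>) \<longlongrightarrow> 0) at_top" by simp
    have "norm (\<epsilon> t) \<le> (L + m * (q * R powr (q - 1))) * \<bar>y t\<bar>" if t: "t0 \<le> t" for t
    proof -
      have "\<bar>(\<alpha> * x t - y t) powr q - (\<alpha> * x t) powr q\<bar> \<le> q * R powr (q - 1) * \<bar>(\<alpha> * x t - y t) - \<alpha> * x t\<bar>"
        using w[OF t] q_gt_1 by (intro powr_lipschitz) auto
      then have "m * \<bar>(\<alpha> * x t - y t) powr q - (\<alpha> * x t) powr q\<bar> \<le> m * (q * R powr (q - 1) * \<bar>y t\<bar>)"
        using m_pos by (intro mult_left_mono) auto
      then have 1: "\<bar>m * ((\<alpha> * x t - y t) powr q - (\<alpha> * x t) powr q)\<bar> \<le> m * (q * R powr (q - 1)) * \<bar>y t\<bar>"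
        using m_pos by (simp add: abs_mult)
      have 2: "\<bar>- L * y t\<bar> = L * \<bar>y t\<bar>" using L_nonneg by (simp add: abs_mult)
      show ?thesis
        unfolding \<epsilon>_def real_norm_def distrib_right using 1 2 by linarith
    qed
    then show "(\<epsilon> \<longlongrightarrow> 0) at_top"
      by (intro Lim_null_comparison[OF _ lim]) (auto simp: eventually_at_top_linorder)
  qed
  \<comment> \<open>\<open>balance (x t)\<close> is \<open>G t\<close> divided by
    \<open>x t powr q\<close>, and this divisor is at least \<open>a powr q\<close>.\<close>
  have "((\<lambda>t. balance (x t)) \<longlongrightarrow> 0) at_top"
  proof (rule Lim_null_comparison)
    have "((\<lambda>t. \<bar>G t\<bar> / a powr q) \<longlongrightarrow> \<bar>0\<bar> / a powr q) at_top"
      using pos by (intro tendsto_intros G_lim) auto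
    then show "((\<lambda>t. \<bar>G t\<bar> / a powr q) \<longlongrightarrow> 0) at_top" by simp
    have "norm (balance (x t)) \<le> \<bar>G t\<bar> / a powr q" if t: "t0 \<le> t" for t
    proof -
      have "a powr q * \<bar>balance (x t)\<bar> \<le> x t powr q * \<bar>balance (x t)\<bar>"
        using pos q_gt_1 xy(1)[OF t] by (intro mult_right_mono powr_mono2) auto
      also have "\<dots> = \<bar>G t\<bar>"
        using balance_force[of "x t"] flow[OF t] abs_mult[of "x t powr q" "balance (x t)"] by (simp add: G_def)
      finally show ?thesis using pos by (simp add: field_simps)
    qed
    then show "eventually (\<lambda>t. norm (balance (x t)) \<le> \<bar>G t\<bar> / a powr q) at_top"
      by (auto simp: eventually_at_top_linorder)
  qed
  note balance_lim = order_tendstoD[OF this]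
  have ge: "eventually (\<lambda>t. t0 \<le> t) at_top" by (rule eventually_ge_at_top)
  \<comment> \<open>Each level \<open>d > X\<close> has positive balance and each positive level
    below \<open>X\<close> negative balance, so a balance tending to 0 eventually separates
    \<open>x\<close> from \<open>d\<close>.\<close>
  show ?thesis
  proof (rule order_tendstoI)
    fix d assume d: "X < d"
    then have "0 < balance d" using balance_strict_mono[of X d] X by simp
    from balance_lim(2)[OF this] ge show "eventually (\<lambda>t. x t < d) at_top"
    proof eventually_elim
      case (elim t)
      then show ?case
        using balance_strict_mono[of d "x t"] d X by (cases "x t" d rule: linorder_cases) auto
    qed
  next
    fix d assume d: "d < X"
    show "eventually (\<lambda>t. d < x t) at_top"
    proof (cases "0 < d")
      case True
      then have "balance d < 0" using balance_strict_mono[of d X] X d by simp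
      from balance_lim(1)[OF this] ge show ?thesis
      proof eventually_elim
        case (elim t)
        then show ?case
          using balance_strict_mono[of "x t" d] flow[of t] by (cases "x t" d rule: linorder_cases) auto
      qed
    next
      case False
      from ge show ?thesis by eventually_elim (use flow False in force)
    qed
  qed
qed

section \<open>Ground states\<close>

text \<open>Because \<open>(p - 1) / (p + 1) = q - 1\<close>, the defining equation is
  \<open>Y powr (q - 1) * balance Y = 0\<close>, and strict monotonicity makes the described root
  unique.\<close>

lemma X_M_eq:
  assumes X: "0 < X" "balance X = 0"
  shows "X_M N p (- m) = X"
proof -
  have pq: "(p - 1) / (p + 1) = q - 1"
    using p_gt_1 by (simp add: q_def field_simps)
  have K: "2 * K_const N p / (p - 1) = \<alpha> * K"
    using p_gt_1 by (simp add: K_const_def K_def \<alpha>_def field_simps)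
  have eq: "Y powr (p - 1) + - m * (2 / (p - 1)) powr (2 * p / (p + 1)) * Y powr ((p - 1) / (p + 1))
      - 2 * K_const N p / (p - 1) = Y powr (q - 1) * balance Y" if "0 < Y" for Y
    unfolding pq K using balance_equation[OF that] by (simp add: \<alpha>_def q_def)
  show ?thesis
    unfolding X_M_def
  proof (rule the_equality)
    show "0 < X \<and> X powr (p - 1) + - m * (2 / (p - 1)) powr (2 * p / (p + 1)) * X powr ((p - 1) / (p + 1))
      - 2 * K_const N p / (p - 1) = 0"
      using eq[of X] X by simp
    fix Y assume Y: "0 < Y \<and> Y powr (p - 1) + - m * (2 / (p - 1)) powr (2 * p / (p + 1)) * Y powr ((p - 1) / (p + 1))
      - 2 * K_const N p / (p - 1) = 0"
    then have "balance Y = 0" using eq[of Y] by simp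
    then show "Y = X"
      using balance_strict_mono[of X Y] balance_strict_mono[of Y X] X Y by (cases X Y rule: linorder_cases) auto
  qed
qed

text \<open>The signs hold for every positive \<open>r\<close>, so the flow runs over the whole
  line. Convergence of \<open>r powr \<alpha> * u r\<close> to the rest point is the asserted
  equivalence.\<close>

lemma decreasing_solution_asymptotics:
  assumes u: "\<And>r. 0 < r \<Longrightarrow> (u has_real_derivative u1 r) (at r)"
    and u1: "\<And>r. 0 < r \<Longrightarrow> (u1 has_real_derivative u2 r) (at r)"
    and sign: "\<And>r. 0 < r \<Longrightarrow> 0 < u r \<and> u1 r \<le> 0"
    and ode: "\<And>r. 0 < r \<Longrightarrow> u2 r + (real N - 1) / r * u1 r + u r powr p = m * (- u1 r) powr q"
    and lim: "(u \<longlongrightarrow> u0) (at_right 0)" "(u1 \<longlongrightarrow> 0) (at_right 0)" and u0: "0 < u0"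
  shows "u \<sim>[at_top] U_M N p (- m)"
proof -
  have flow: "flow (ef_x u) (ef_y u u1) t \<and> 0 < ef_x u t \<and> ef_y u u1 t \<le> \<alpha> * ef_x u t" for t
  proof (intro conjI)
    show "flow (ef_x u) (ef_y u u1) t"
      using u[of "exp t"] u1[of "exp t"] sign[of "exp t"] ode[of "exp t"] by (intro ef_flow) auto
    show "0 < ef_x u t" using sign[of "exp t"] by (simp add: ef_x_def)
    show "ef_y u u1 t \<le> \<alpha> * ef_x u t"
      using sign[of "exp t"] by (simp add: ef_y_def mult_nonneg_nonpos)
  qed
  have "\<exists>t0 c. 0 < c \<and> (\<forall>t\<ge>t0. energy (ef_x u t) (ef_y u u1 t) \<le> - c)"
    by (rule energy_negative[OF UNIV_I UNIV_not_empty flow ef_at_bot[OF lim u0]]) blast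
  then obtain t0 c where c: "0 < c" "\<And>t. t0 \<le> t \<Longrightarrow> energy (ef_x u t) (ef_y u u1 t) \<le> - c"
    by blast
  obtain X where X: "0 < X" "balance X = 0" using balance_root by blast
  have "(ef_x u \<longlongrightarrow> X) at_top"
    using trajectory_converges[of t0 "ef_x u" "ef_y u u1" c X] flow c X by blast
  from filterlim_compose[OF this ln_at_top]
  have "((\<lambda>r. ef_x u (ln r) / X) \<longlongrightarrow> X / X) at_top"
    using X by (intro tendsto_divide tendsto_const) auto
  then have "((\<lambda>r. ef_x u (ln r) / X) \<longlongrightarrow> 1) at_top" using X by simp
  moreover have "eventually (\<lambda>r. ef_x u (ln r) / X = u r / U_M N p (- m) r) at_top"
    using eventually_gt_at_top[of "0::real"]
  proof eventually_elim
    case (elim r)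
    have "- 2 / (p - 1) = - \<alpha>" by (simp add: \<alpha>_def)
    then have "U_M N p (- m) r = X * r powr (- \<alpha>)" by (simp only: U_M_def X_M_eq[OF X])
    moreover have "ef_x u (ln r) = r powr \<alpha> * u r"
      using elim by (simp add: ef_x_def powr_def)
    ultimately show ?case using elim X by (simp only: powr_minus) (simp add: field_simps)
  qed
  ultimately have "((\<lambda>r. u r / U_M N p (- m) r) \<longlongrightarrow> 1) at_top"
    by (rule Lim_transform_eventually)
  then show ?thesis by (rule asymp_equivI')
qed

text \<open>Rigidity: \<open>H = u\<^sup>2 + u1\<^sup>2\<close> satisfies \<open>\<bar>H'\<bar> \<le> C H\<close> away from the origin, while towards increasing \<open>r\<close>
  the singular term has the good sign.\<close>

lemma nonneg_solution_positive:
  assumes u: "\<And>r. 0 < r \<Longrightarrow> (u has_real_derivative u1 r) (at r)"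
    and u1: "\<And>r. 0 < r \<Longrightarrow> (u1 has_real_derivative u2 r) (at r)"
    and cont: "continuous_on {0..} u" "continuous_on {0..} u1" and u1_0: "u1 0 = 0"
    and nonneg: "\<And>r. 0 \<le> r \<Longrightarrow> 0 \<le> u r"
    and ode: "\<And>r. 0 < r \<Longrightarrow> u2 r + (real N - 1) / r * u1 r + u r powr p = m * \<bar>u1 r\<bar> powr q"
    and nontriv: "0 < s" "u s \<noteq> 0"
    and r0: "0 \<le> r0"
  shows "0 < u r0"
proof (rule ccontr)
  assume "\<not> 0 < u r0"
  then have u_r0: "u r0 = 0" using nonneg[OF r0] by simp
  \<comment> \<open>A zero of the nonnegative \<open>u\<close> at positive radius is a minimum; at
    the origin the slope vanishes by assumption.\<close>
  have u1_r0: "u1 r0 = 0"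
  proof (cases "r0 = 0")
    case False
    then have "0 < r0" using r0 by simp
    then show ?thesis
      using DERIV_local_min[OF u[of r0], of r0] u_r0 nonneg by (simp add: abs_less_iff)
  qed (use u1_0 in simp)
  define H where "H r = (u r)\<^sup>2 + (u1 r)\<^sup>2" for r
  define H' where "H' r = 2 * u r * u1 r + 2 * u1 r * u2 r" for r
  have dH: "(H has_real_derivative H' r) (at r)" if "0 < r" for r
    unfolding H_def[abs_def] H'_def
    by (rule derivative_eq_intros u u1 that refl)+ simp
  have H_cont: "continuous_on {a..b} H" if "0 \<le> a" for a b
    unfolding H_def[abs_def] using that
    by (intro continuous_intros continuous_on_subset[OF cont(1)] continuous_on_subset[OF cont(2)]) auto
  have H0: "H r0 = 0" using u_r0 u1_r0 by (simp add: H_def)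
  define b where "b = max s r0"
  have "bounded (u ` {0..b})" "bounded (u1 ` {0..b})"
    by (intro compact_imp_bounded compact_continuous_image continuous_on_subset[OF cont(1)]
        continuous_on_subset[OF cont(2)], auto)+
  then obtain B1 B2 where B: "\<And>r. 0 \<le> r \<Longrightarrow> r \<le> b \<Longrightarrow> \<bar>u r\<bar> \<le> B1" "\<And>r. 0 \<le> r \<Longrightarrow> r \<le> b \<Longrightarrow> \<bar>u1 r\<bar> \<le> B2"
    unfolding bounded_iff by fastforce
  \<comment> \<open>One summand each for the product of \<open>u\<close> and \<open>u1\<close>, the
    power of \<open>u\<close> and the gradient term in \<open>H'\<close>. The friction term is kept
    apart, its coefficient being unbounded near the origin.\<close>
  define C where "C = 1 + B1 powr (p - 1) + 2 * m * B2 powr (q - 1)"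
  have main: "\<bar>H' r + 2 * ((real N - 1) / r) * (u1 r)\<^sup>2\<bar> \<le> C * H r" if r: "0 < r" "r \<le> b" for r
  proof -
    have ur: "0 \<le> u r" using nonneg r by simp
    have 1: "u r powr p \<le> B1 powr (p - 1) * u r"
    proof -
      have "u r powr p = u r powr (p - 1) * u r"
        using ur p_gt_1 by (cases "u r = 0") (simp_all add: powr_mult_base mult.commute)
      also have "\<dots> \<le> B1 powr (p - 1) * u r"
        using ur B(1)[of r] r p_gt_1 by (intro mult_right_mono powr_mono2) auto
      finally show ?thesis .
    qed
    have 2: "\<bar>u1 r\<bar> powr q \<le> B2 powr (q - 1) * \<bar>u1 r\<bar>"
    proof -
      have "\<bar>u1 r\<bar> powr q = \<bar>u1 r\<bar> powr (q - 1) * \<bar>u1 r\<bar>"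
        using q_gt_1 by (cases "u1 r = 0") (simp_all add: powr_mult_base mult.commute)
      also have "\<dots> \<le> B2 powr (q - 1) * \<bar>u1 r\<bar>"
        using B(2)[of r] r q_gt_1 by (intro mult_right_mono powr_mono2) auto
      finally show ?thesis .
    qed
    have am: "2 * \<bar>u1 r\<bar> * u r \<le> H r"
      using zero_le_power2[of "\<bar>u1 r\<bar> - u r"] by (simp add: H_def power2_diff)
    have u2r: "u2 r = m * \<bar>u1 r\<bar> powr q - u r powr p - (real N - 1) / r * u1 r"
      using ode[OF r(1)] by simp
    have "H' r + 2 * ((real N - 1) / r) * (u1 r)\<^sup>2
        = 2 * u1 r * u r - 2 * u1 r * u r powr p + 2 * m * u1 r * \<bar>u1 r\<bar> powr q"
      unfolding H'_def u2r by (simp add: algebra_simps power2_eq_square)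
    also have "\<bar>\<dots>\<bar> \<le> \<bar>2 * u1 r * u r\<bar> + \<bar>2 * u1 r * u r powr p\<bar> + \<bar>2 * m * u1 r * \<bar>u1 r\<bar> powr q\<bar>"
      by linarith
    also have "\<dots> = 2 * \<bar>u1 r\<bar> * u r + 2 * \<bar>u1 r\<bar> * u r powr p + 2 * m * (\<bar>u1 r\<bar> * \<bar>u1 r\<bar> powr q)"
      using m_pos ur by (simp add: abs_mult)
    also have "\<dots> \<le> H r + B1 powr (p - 1) * H r + 2 * m * (B2 powr (q - 1) * H r)"
    proof (intro add_mono am)
      have "2 * \<bar>u1 r\<bar> * u r powr p \<le> 2 * \<bar>u1 r\<bar> * (B1 powr (p - 1) * u r)"
        using 1 by (intro mult_left_mono) auto
      also have "\<dots> = B1 powr (p - 1) * (2 * \<bar>u1 r\<bar> * u r)" by simp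
      also have "\<dots> \<le> B1 powr (p - 1) * H r" using am by (intro mult_left_mono) auto
      finally show "2 * \<bar>u1 r\<bar> * u r powr p \<le> B1 powr (p - 1) * H r" .
      have "\<bar>u1 r\<bar> * \<bar>u1 r\<bar> powr q \<le> \<bar>u1 r\<bar> * (B2 powr (q - 1) * \<bar>u1 r\<bar>)"
        using 2 by (intro mult_left_mono) auto
      also have "\<dots> = B2 powr (q - 1) * (u1 r)\<^sup>2" by (simp add: power2_eq_square)
      also have "\<dots> \<le> B2 powr (q - 1) * H r" by (intro mult_left_mono) (simp_all add: H_def)
      finally show "2 * m * (\<bar>u1 r\<bar> * \<bar>u1 r\<bar> powr q) \<le> 2 * m * (B2 powr (q - 1) * H r)"
        using m_pos by simp
    qed
    also have "\<dots> = C * H r" by (simp add: C_def algebra_simps)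
    finally show ?thesis .
  qed
  have N1: "0 \<le> real N - 1" using N_ge by simp
  have "H s \<le> 0"
  proof (cases "r0 \<le> s")
    case True
    show ?thesis
    proof (rule gronwall_zero_forward[of r0 s H H' C])
      fix r assume r: "r0 < r" "r < s"
      have "0 \<le> 2 * ((real N - 1) / r) * (u1 r)\<^sup>2" using N1 r r0 by simp
      moreover have "r \<le> b" "0 < r" using r r0 by (simp_all add: b_def)
      moreover have "h \<le> c" if "0 \<le> T" "\<bar>h + T\<bar> \<le> c" for h T c :: real
        using that by linarith
      ultimately show "H' r \<le> C * H r" using main[of r] by blast
    qed (use True r0 H0 H_cont dH in auto)
  next
    case False
    \<comment> \<open>Going left, friction has the unfavourable sign, but its coefficient does not
      exceed its value at \<open>s > 0\<close>.\<close>
    define C' where "C' = C + 2 * ((real N - 1) / s)"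
    show ?thesis
    proof (rule gronwall_zero_backward[of s r0 H H' C'])
      fix r assume r: "s < r" "r < r0"
      have "2 * ((real N - 1) / r) * (u1 r)\<^sup>2 \<le> 2 * ((real N - 1) / s) * H r"
        using N1 r nontriv by (intro mult_mono divide_left_mono) (auto simp: H_def)
      moreover have "\<bar>H' r + 2 * ((real N - 1) / r) * (u1 r)\<^sup>2\<bar> \<le> C * H r"
        using main[of r] r nontriv by (simp add: b_def)
      moreover have "- (c + Q) \<le> h" if "T \<le> Q" "\<bar>h + T\<bar> \<le> c" for h T Q c :: real
        using that by linarith
      ultimately show "- C' * H r \<le> H' r"
        unfolding C'_def minus_mult_left[symmetric] distrib_right by blast
    qed (use False nontriv H0 H_cont dH in auto)
  qed
  then have "(u s)\<^sup>2 \<le> 0" using zero_le_power2[of "u1 s"] unfolding H_def by linarith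
  then show False using nontriv by simp
qed

text \<open>Near the origin the gradient term is smaller than \<open>u powr p\<close>, so
  \<open>r ^ n * u1 r\<close> decreases from 0. At a first later zero of \<open>u1\<close> the
  equation leaves \<open>u2 = - (u powr p) < 0\<close>, making \<open>u1\<close> positive just
  before it, a contradiction.\<close>

lemma positive_solution_decreasing:
  assumes u1: "\<And>r. 0 < r \<Longrightarrow> (u1 has_real_derivative u2 r) (at r)"
    and cont: "continuous_on {0..} u" "continuous_on {0..} u1" and u1_0: "u1 0 = 0"
    and pos: "\<And>r. 0 \<le> r \<Longrightarrow> 0 < u r"
    and ode: "\<And>r. 0 < r \<Longrightarrow> u2 r + (real N - 1) / r * u1 r + u r powr p = m * \<bar>u1 r\<bar> powr q"
    and r: "0 < r"
  shows "u1 r < 0"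
proof -
  define n where "n = N - 1"
  have n: "real n = real N - 1" "0 < n" using N_ge by (auto simp: n_def)
  have "((\<lambda>s. u s powr p - m * \<bar>u1 s\<bar> powr q) \<longlongrightarrow> u 0 powr p - m * \<bar>u1 0\<bar> powr q) (at 0 within {0..})"
    using cont pos[of 0] q_gt_1 by (intro tendsto_intros) (auto simp: continuous_on_def)
  then have "((\<lambda>s. u s powr p - m * \<bar>u1 s\<bar> powr q) \<longlongrightarrow> u 0 powr p) (at_right 0)"
    using u1_0 by (simp add: at_within_Ici_at_right)
  then have "eventually (\<lambda>s. 0 < u s powr p - m * \<bar>u1 s\<bar> powr q) (at_right 0)"
    by (rule order_tendstoD(1)) (use pos[of 0] in simp)
  then obtain d where d: "0 < d" "\<And>s. 0 < s \<Longrightarrow> s < d \<Longrightarrow> 0 < u s powr p - m * \<bar>u1 s\<bar> powr q"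
    by (auto simp: eventually_at_right_field)
  have near: "u1 s < 0" if s: "0 < s" "s < d" for s
  proof -
    have "s ^ n * u1 s < 0 ^ n * u1 0"
    proof (rule DERIV_neg_imp_decreasing_open[of 0 s "\<lambda>s. s ^ n * u1 s", OF s(1)])
      fix t assume t: "0 < t" "t < s"
      have "((\<lambda>s. s ^ n * u1 s) has_real_derivative (real n * t ^ (n - 1) * u1 t + t ^ n * u2 t)) (at t)"
        by (rule derivative_eq_intros u1 t refl)+ simp
      moreover have "real n * t ^ (n - 1) * u1 t + t ^ n * u2 t = - (t ^ n * (u t powr p - m * \<bar>u1 t\<bar> powr q))"
      proof -
        have "t ^ n = t * t ^ (n - 1)" using n by (simp add: power_eq_if)
        then have "real n * t ^ (n - 1) * u1 t = t ^ n * ((real N - 1) / t * u1 t)"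
          using t n by simp
        moreover have "u2 t = m * \<bar>u1 t\<bar> powr q - u t powr p - (real N - 1) / t * u1 t"
          using ode[OF t(1)] by simp
        ultimately show ?thesis by (simp add: right_diff_distrib)
      qed
      moreover have "0 < t ^ n * (u t powr p - m * \<bar>u1 t\<bar> powr q)"
        using d(2)[of t] t s by simp
      ultimately show "\<exists>D. ((\<lambda>s. s ^ n * u1 s) has_real_derivative D) (at t) \<and> D < 0"
        by force
    qed (intro continuous_intros continuous_on_subset[OF cont(2)], auto)
    then show ?thesis using s u1_0 by (simp add: mult_less_0_iff)
  qed
  show ?thesis
  proof (rule ccontr)
    assume "\<not> u1 r < 0"
    define a where "a = min r d / 2"
    have a: "0 < a" "a < d" "a \<le> r" using r d by (auto simp: a_def)
    obtain z where z: "a < z" "z \<le> r" "- u1 z = 0" "\<And>s. a \<le> s \<Longrightarrow> s < z \<Longrightarrow> 0 < - u1 s"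
    proof (rule first_zero[of a r "\<lambda>s. - u1 s"])
      show "continuous_on {a..r} (\<lambda>s. - u1 s)"
        using a by (intro continuous_intros continuous_on_subset[OF cont(2)]) auto
    qed (use a near[of a] \<open>\<not> u1 r < 0\<close> in auto)
    have "0 < u z powr p" using pos[of z] z a by simp
    moreover have "u2 z = - (u z powr p)" using ode[of z] z a by simp
    ultimately have "u2 z < 0" by linarith
    then obtain e where e: "0 < e" "\<And>h. 0 < h \<Longrightarrow> h < e \<Longrightarrow> u1 z < u1 (z - h)"
      using DERIV_neg_dec_left[OF u1[of z]] z a by force
    define h where "h = min e (z - a) / 2"
    have "0 < h" "h < e" "a \<le> z - h" using e z by (auto simp: h_def min_def field_simps)
    then show False using e(2)[of h] z(3) z(4)[of "z - h"] by simp
  qed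
qed

lemma ground_state_asymptotics:
  assumes gs: "ground_state N p (- m) u" and nontriv: "\<exists>r\<ge>0. u r \<noteq> 0"
  shows "u \<sim>[at_top] U_M N p (- m)"
proof -
  obtain u1 u2 where nonneg: "\<And>r. 0 \<le> r \<Longrightarrow> 0 \<le> u r"
    and u: "\<And>r. 0 \<le> r \<Longrightarrow> (u has_real_derivative u1 r) (at r within {0..})"
    and u1: "\<And>r. 0 \<le> r \<Longrightarrow> (u1 has_real_derivative u2 r) (at r within {0..})"
    and u1_0: "u1 0 = 0"
    and eq: "\<And>r. 0 < r \<Longrightarrow> - u2 r - (real N - 1) / r * u1 r
                 = \<bar>u r\<bar> powr (p - 1) * u r + - m * \<bar>u1 r\<bar> powr (2 * p / (p + 1))"
    using gs unfolding ground_state_def by blast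
  have at: "at r within {0..} = at r" if "0 < r" for r :: real
    using that by (intro at_within_interior) auto
  have du: "(u has_real_derivative u1 r) (at r)" and du1: "(u1 has_real_derivative u2 r) (at r)"
    if "0 < r" for r
    using u[of r] u1[of r] at[OF that] that by auto
  have cont: "continuous_on {0..} u" "continuous_on {0..} u1"
    using u u1 by (auto intro!: DERIV_continuous_on)
  have ode: "u2 r + (real N - 1) / r * u1 r + u r powr p = m * \<bar>u1 r\<bar> powr q" if r: "0 < r" for r
  proof -
    have "\<bar>u r\<bar> powr (p - 1) * u r = u r powr p"
      using nonneg[of r] r p_gt_1 by (cases "u r = 0") (simp_all add: powr_mult_base mult.commute)
    then show ?thesis using eq[OF r] unfolding q_def by linarith
  qed
  \<comment> \<open>If the given nonzero value sits at the origin, continuity moves it to a positive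
    radius, where the equation holds.\<close>
  have "\<exists>s>0. u s \<noteq> 0"
  proof (rule ccontr)
    assume z: "\<not> (\<exists>s>0. u s \<noteq> 0)"
    have "(u \<longlongrightarrow> u 0) (at_right 0)"
      using cont(1) by (simp add: continuous_on_def flip: at_within_Ici_at_right)
    moreover have "(u \<longlongrightarrow> 0) (at_right 0)"
      using z by (intro tendsto_eventually) (auto simp: eventually_at_right_field intro!: exI[of _ 1])
    ultimately have "u 0 = 0" using tendsto_unique by (metis trivial_limit_at_right_real)
    then show False using z nontriv by (metis order_le_less)
  qed
  then obtain s where s: "0 < s" "u s \<noteq> 0" by blast
  have pos: "0 < u r" if "0 \<le> r" for r
    by (rule nonneg_solution_positive[of u u1 u2 s r]) (use du du1 cont u1_0 nonneg ode s that in blast)+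
  have neg: "u1 r < 0" if "0 < r" for r
    by (rule positive_solution_decreasing[of u1 u2 u r]) (use du1 cont u1_0 pos ode that in blast)+
  show ?thesis
  proof (rule decreasing_solution_asymptotics[OF du du1])
    show "0 < u r \<and> u1 r \<le> 0" if "0 < r" for r
      using pos[of r] neg[OF that] that by simp
    show "u2 r + (real N - 1) / r * u1 r + u r powr p = m * (- u1 r) powr q" if "0 < r" for r
      using ode[OF that] neg[OF that] by simp
    show "(u \<longlongrightarrow> u 0) (at_right 0)"
      using cont(1) by (simp add: continuous_on_def flip: at_within_Ici_at_right)
    show "(u1 \<longlongrightarrow> 0) (at_right 0)"
      using cont(2) u1_0 by (force simp: continuous_on_def simp flip: at_within_Ici_at_right)
    show "0 < u 0" using pos[of 0] by simp
  qed
qed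

section \<open>Existence of a ground state\<close>

text \<open>At a first zero \<open>R\<close> the energy reduces to \<open>y\<^sup>2 / 2\<close>, yet
  it is the limit of values bounded above by a negative constant. The equation is required only
  where \<open>u\<close> is positive, so a truncated nonlinearity qualifies.\<close>

lemma decreasing_solution_positive:
  assumes du: "\<And>r. 0 < r \<Longrightarrow> (u has_real_derivative - v r) (at r)"
    and dv: "\<And>r. 0 < r \<Longrightarrow> (v has_real_derivative v' r) (at r)"
    and cont: "continuous_on {0..} u" "continuous_on {0..} v"
    and v_ge: "\<And>r. 0 \<le> r \<Longrightarrow> 0 \<le> v r" and init: "0 < u 0" "v 0 = 0"
    and ode: "\<And>r. 0 < r \<Longrightarrow> 0 < u r \<Longrightarrow> - v' r - (real N - 1) / r * v r + u r powr p = m * v r powr q"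
    and r: "0 \<le> r"
  shows "0 < u r"
proof (rule ccontr)
  assume "\<not> 0 < u r"
  then obtain R where R: "0 < R" "u R = 0" "\<And>s. 0 \<le> s \<Longrightarrow> s < R \<Longrightarrow> 0 < u s"
    using first_zero[of 0 r u] continuous_on_subset[OF cont(1), of "{0..r}"] init r by auto
  let ?x = "ef_x u" and ?y = "ef_y u (\<lambda>r. - v r)"
  have lim: "(u \<longlongrightarrow> u 0) (at_right 0)" "((\<lambda>r. - v r) \<longlongrightarrow> 0) (at_right 0)"
  proof -
    show "(u \<longlongrightarrow> u 0) (at_right 0)"
      using cont(1) by (simp add: continuous_on_def flip: at_within_Ici_at_right)
    have "(v \<longlongrightarrow> 0) (at_right 0)"
      using cont(2) init by (force simp: continuous_on_def simp flip: at_within_Ici_at_right)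
    from tendsto_minus[OF this] show "((\<lambda>r. - v r) \<longlongrightarrow> 0) (at_right 0)" by simp
  qed
  have flow: "flow ?x ?y t \<and> 0 < ?x t \<and> ?y t \<le> \<alpha> * ?x t" if "t \<in> {..<ln R}" for t
  proof -
    have "exp t < exp (ln R)" using that by simp
    then have tR: "exp t < R" using R by simp
    have pos: "0 < u (exp t)" "0 \<le> v (exp t)" using R(3)[of "exp t"] tR v_ge by auto
    have "flow ?x ?y t"
    proof (rule ef_flow)
      show "(u has_real_derivative - v (exp t)) (at (exp t))" by (rule du) simp
      show "((\<lambda>r. - v r) has_real_derivative - v' (exp t)) (at (exp t))"
        by (intro DERIV_minus dv) simp
    qed (use pos ode[of "exp t"] in auto)
    then show ?thesis using pos by (simp add: ef_x_def ef_y_def)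
  qed
  have down: "s \<in> {..<ln R}" if "t \<in> {..<ln R}" "s \<le> t" for s t using that by simp
  have ne: "{..<ln R} \<noteq> {}" by simp
  have "\<exists>t0 c. t0 < ln R \<and> 0 < c \<and> (\<forall>t. t < ln R \<longrightarrow> t0 \<le> t \<longrightarrow> energy (?x t) (?y t) \<le> - c)"
    by (rule energy_negative[of "{..<ln R}" ?x ?y]) (fact down ne flow ef_at_bot[OF lim init(1)] | force)+
  then obtain t0 c where t0: "t0 < ln R" and c: "0 < c"
    "\<And>t. t < ln R \<Longrightarrow> t0 \<le> t \<Longrightarrow> energy (?x t) (?y t) \<le> - c"
    by blast
  have "isCont u (exp (ln R))" "isCont v (exp (ln R))"
    using DERIV_isCont[OF du[of R]] DERIV_isCont[OF dv[of R]] R(1) by simp_all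
  then have cu: "isCont (\<lambda>t. u (exp t)) (ln R)" and cv: "isCont (\<lambda>t. v (exp t)) (ln R)"
    by (auto intro: isCont_o2[where g = u] isCont_o2[where g = v] isCont_exp)
  have "isCont ?x (ln R)" "isCont ?y (ln R)"
    unfolding ef_x_def[abs_def] ef_y_def[abs_def]
    by (intro isCont_mult isCont_add isCont_minus cu cv isCont_exp' continuous_const continuous_ident)+
  then have xy: "(?x \<longlongrightarrow> ?x (ln R)) (at_left (ln R))" "(?y \<longlongrightarrow> ?y (ln R)) (at_left (ln R))"
    by (auto simp: isCont_def filterlim_at_split)
  have ev: "eventually (\<lambda>t. t0 < t \<and> t < ln R) (at_left (ln R))"
    using t0 by (auto simp: eventually_at_left_field)
  have "((\<lambda>t. energy (?x t) (?y t)) \<longlongrightarrow> energy (?x (ln R)) (?y (ln R))) (at_left (ln R))"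
  proof (rule energy_tendsto[OF xy])
    from ev show "eventually (\<lambda>t. 0 \<le> ?x t) (at_left (ln R))"
      by eventually_elim (use flow in force)
  qed
  moreover from ev have "eventually (\<lambda>t. energy (?x t) (?y t) \<le> - c) (at_left (ln R))"
    by eventually_elim (use c in force)
  ultimately have "energy (?x (ln R)) (?y (ln R)) \<le> - c"
    by (rule tendsto_upperbound) simp
  moreover have "?x (ln R) = 0" using R by (simp add: ef_x_def)
  then have "0 \<le> energy (?x (ln R)) (?y (ln R))" by (simp add: energy_def)
  ultimately show False using c by simp
qed

text \<open>Truncation supplies the global Lipschitz and boundedness conditions of
  \<open>radial_Cauchy_problem\<close>. The bounds on \<open>v\<close>, the bound
  \<open>u \<le> 1\<close> and positivity of \<open>u\<close> then show that the solution obeys the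
  original equation.\<close>

lemma ground_state_exists: "\<exists>u. ground_state N p (- m) u \<and> (\<exists>r\<ge>0. u r \<noteq> 0)"
proof -
  define n where "n = N - 1"
  have n: "real n = real N - 1" "0 < n" using N_ge by (auto simp: n_def)
  \<comment> \<open>A decreasing solution with \<open>u 0 = 1\<close> satisfies \<open>- u' \<le> V\<close>, so cutting off the nonlinearity
    at \<open>u = 1\<close> and \<open>- u' = V\<close> loses nothing.\<close>
  define V where "V = (1 / m) powr (1 / q)"
  have V: "0 < V" using m_pos by (simp add: V_def)
  have mV: "m * V powr q = 1" using m_pos q_gt_1 by (simp add: V_def powr_powr)
  define f where "f u v = (max 0 (min u 1)) powr p - m * (max 0 (min v V)) powr q" for u v :: real
  define C where "C = max (p * 1 powr (p - 1)) (m * (q * V powr (q - 1)))"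
  have lip: "\<bar>f u v - f u' v'\<bar> \<le> C * (\<bar>u - u'\<bar> + \<bar>v - v'\<bar>)" for u u' v v'
  proof -
    have "p * 1 powr (p - 1) * \<bar>u - u'\<bar> \<le> C * \<bar>u - u'\<bar>"
      by (intro mult_right_mono) (simp_all add: C_def)
    then have 1: "\<bar>(max 0 (min u 1)) powr p - (max 0 (min u' 1)) powr p\<bar> \<le> C * \<bar>u - u'\<bar>"
      using clamp_powr_lipschitz[of p 1 u u'] p_gt_1 by simp
    have "m * \<bar>(max 0 (min v V)) powr q - (max 0 (min v' V)) powr q\<bar> \<le> m * (q * V powr (q - 1) * \<bar>v - v'\<bar>)"
      using clamp_powr_lipschitz[of q V v v'] q_gt_1 V m_pos by (intro mult_left_mono) auto
    also have "\<dots> = m * (q * V powr (q - 1)) * \<bar>v - v'\<bar>" by simp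
    also have "\<dots> \<le> C * \<bar>v - v'\<bar>" by (intro mult_right_mono) (simp_all add: C_def)
    finally have 2: "\<bar>m * ((max 0 (min v V)) powr q - (max 0 (min v' V)) powr q)\<bar> \<le> C * \<bar>v - v'\<bar>"
      using m_pos by (simp add: abs_mult)
    have eq: "f u v - f u' v' = ((max 0 (min u 1)) powr p - (max 0 (min u' 1)) powr p)
        - m * ((max 0 (min v V)) powr q - (max 0 (min v' V)) powr q)"
      by (simp add: f_def algebra_simps)
    show ?thesis
      unfolding eq distrib_left by (rule order_trans[OF abs_triangle_ineq4 add_mono[OF 1 2]])
  qed
  have bound: "\<bar>f u v\<bar> \<le> 1" for u v
  proof -
    have "(max 0 (min u 1)) powr p \<le> 1 powr p" using p_gt_1 by (intro powr_mono2) auto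
    moreover have "m * (max 0 (min v V)) powr q \<le> m * V powr q"
      using m_pos q_gt_1 V by (intro mult_left_mono powr_mono2) auto
    moreover have "0 \<le> m * (max 0 (min v V)) powr q" using m_pos by simp
    moreover have "\<bar>a - b\<bar> \<le> 1" if "a \<le> 1" "b \<le> 1" "0 \<le> a" "0 \<le> b" for a b :: real
      using that by linarith
    ultimately show ?thesis unfolding f_def mV powr_one_eq_one using powr_ge_zero by blast
  qed
  have C0: "0 \<le> C" using p_gt_1 by (simp add: C_def)
  obtain u v where u_0: "u 0 = 1" and v_0: "v 0 = 0"
    and du: "\<And>r. 0 \<le> r \<Longrightarrow> (u has_real_derivative - v r) (at r within {0..})"
    and dv: "\<And>r. 0 < r \<Longrightarrow> (v has_real_derivative f (u r) (v r) - real n / r * v r) (at r)"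
    and v_slope: "((\<lambda>r. v r / r) \<longlongrightarrow> f 1 0 / real (Suc n)) (at_right 0)"
    and v_cont: "continuous_on {0..} v" and F_cont: "continuous_on {0..} (\<lambda>r. f (u r) (v r))"
    by (rule radial_Cauchy_problem[where f = f and C = C and B = 1 and n = n and a = 1, OF lip bound C0 n(2)]) (rule that; assumption)
  define F where "F s = f (u s) (v s)" for s
  have Fc: "continuous_on {0..} F" using F_cont by (simp add: F_def[abs_def])
  have dv: "(v has_real_derivative F r - real n / r * v r) (at r)" if "0 < r" for r
    using dv[OF that] by (simp add: F_def)
  have at: "at r within {0..} = at r" if "0 < r" for r :: real
    using that by (intro at_within_interior) auto
  have u_cont: "continuous_on {0..} u"
    using du by (auto intro!: DERIV_continuous_on)
  have v_cont': "continuous_on {0..b} v" for b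
    by (rule continuous_on_subset[OF v_cont]) simp
  \<comment> \<open>Above \<open>V\<close> the truncated gradient term equals 1 and dominates the
    power of \<open>u\<close>, while friction also pushes \<open>v\<close> down.\<close>
  have v_le: "v r \<le> V" if "0 \<le> r" for r
  proof (rule barrier[of 0 r v "\<lambda>r. F r - real n / r * v r"])
    show "F s - real n / s * v s \<le> 0" if s: "0 < s" "s < r" "V < v s" for s
    proof -
      have "(max 0 (min (u s) 1)) powr p \<le> 1 powr p" using p_gt_1 by (intro powr_mono2) auto
      moreover have "max 0 (min (v s) V) = V" using s V by simp
      ultimately have "F s \<le> 0" by (simp add: F_def f_def mV)
      moreover have "0 \<le> real n / s * v s" using s V by (intro mult_nonneg_nonneg) auto
      ultimately show ?thesis by linarith
    qed
  qed (use that dv v_0 V v_cont' in auto)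
  \<comment> \<open>Where \<open>v\<close> is negative the truncated gradient term vanishes, so the
    source is nonnegative and friction pushes \<open>v\<close> up.\<close>
  have v_ge: "0 \<le> v r" if "0 \<le> r" for r
  proof -
    have "- v r \<le> 0"
    proof (rule barrier[of 0 r "\<lambda>r. - v r" "\<lambda>r. - (F r - real n / r * v r)"])
      show "- (F s - real n / s * v s) \<le> 0" if s: "0 < s" "s < r" "0 < - v s" for s
      proof -
        have "max 0 (min (v s) V) = 0" using s by simp
        then have "0 \<le> F s" using q_gt_1 by (simp add: F_def f_def)
        moreover have "real n / s * v s \<le> 0" using s by (intro mult_nonneg_nonpos) auto
        ultimately show ?thesis by linarith
      qed
      show "((\<lambda>r. - v r) has_real_derivative - (F s - real n / s * v s)) (at s)" if "0 < s" for s
        by (intro DERIV_minus dv that)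
      show "continuous_on {0..r} (\<lambda>r. - v r)"
        by (intro continuous_intros v_cont')
    qed (use that v_0 in auto)
    then show ?thesis by simp
  qed
  have u_le: "u r \<le> 1" if "0 \<le> r" for r
  proof (rule barrier[of 0 r u "\<lambda>r. - v r"])
    show "(u has_real_derivative - v s) (at s)" if "0 < s" for s
      using du[of s] at[OF that] that by simp
    show "continuous_on {0..r} u" by (rule continuous_on_subset[OF u_cont]) simp
  qed (use that v_ge u_0 in auto)
  have F_eq: "F r = u r powr p - m * v r powr q" if "0 \<le> r" "0 \<le> u r" for r
  proof -
    have "max 0 (min (u r) 1) = u r" "max 0 (min (v r) V) = v r"
      using that u_le[of r] v_le[of r] v_ge[of r] by simp_all
    then show ?thesis by (simp only: F_def f_def)
  qed
  have u_pos: "0 < u r" if "0 \<le> r" for r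
  proof (rule decreasing_solution_positive[of u v "\<lambda>r. F r - real n / r * v r"])
    show "(u has_real_derivative - v s) (at s)" if "0 < s" for s
      using du[of s] at[OF that] that by simp
    show "- (F s - real n / s * v s) - (real N - 1) / s * v s + u s powr p = m * v s powr q"
      if "0 < s" "0 < u s" for s
      using F_eq[of s] that n by simp
  qed (use that dv u_cont v_cont v_ge u_0 v_0 in auto)
  \<comment> \<open>The value at the origin is minus the limit \<open>1 / real N\<close> of
    \<open>v r / r\<close>. It also equals \<open>- (1 - real n / real N)\<close>, the limit of the
    formula for positive \<open>r\<close>, which gives continuity of the second derivative.\<close>
  define u2 where "u2 r = (if r = 0 then - 1 / real N else - (F r - real n / r * v r))" for r
  have F_0: "F 0 = 1" using F_eq[of 0] u_0 v_0 q_gt_1 by simp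
  have F_lim: "(F \<longlongrightarrow> 1) (at_right 0)"
    using Fc F_0 by (force simp: continuous_on_def simp flip: at_within_Ici_at_right)
  have "real (Suc n) = real N" "f 1 0 = 1" using n V q_gt_1 by (simp_all add: f_def)
  with v_slope have v_slope: "((\<lambda>r. v r / r) \<longlongrightarrow> 1 / real N) (at_right 0)" by simp
  have du1: "((\<lambda>r. - v r) has_real_derivative u2 r) (at r within {0..})" if r: "0 \<le> r" for r
  proof (cases "r = 0")
    case True
    have "((\<lambda>r. (- v r - - v 0) / (r - 0)) \<longlongrightarrow> - (1 / real N)) (at_right 0)"
      using tendsto_minus[OF v_slope] v_0 by simp
    then show ?thesis
      using True by (simp add: has_field_derivative_iff u2_def at_within_Ici_at_right)
  next
    case False
    then show ?thesis
      using r DERIV_minus[OF dv[of r]] at[of r] by (simp add: u2_def)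
  qed
  have u2_cont: "continuous_on {0..} u2"
    unfolding continuous_on_def
  proof
    fix r :: real assume r: "r \<in> {0..}"
    show "(u2 \<longlongrightarrow> u2 r) (at r within {0..})"
    proof (cases "r = 0")
      case True
      have "((\<lambda>r. - (F r - real n * (v r / r))) \<longlongrightarrow> - (1 - real n * (1 / real N))) (at_right 0)"
        by (intro tendsto_intros F_lim v_slope)
      moreover have "- (1 - real n * (1 / real N)) = - 1 / real N"
        using N_ge n by (simp add: field_simps)
      moreover have "eventually (\<lambda>r. - (F r - real n * (v r / r)) = u2 r) (at_right 0)"
        by (auto simp: eventually_at_right_field u2_def intro!: exI[of _ 1])
      ultimately have "(u2 \<longlongrightarrow> - 1 / real N) (at_right 0)"
        using Lim_transform_eventually by force
      then show ?thesis using True by (simp add: u2_def at_within_Ici_at_right)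
    next
      case False
      then have r0: "0 < r" using r by simp
      have "(F \<longlongrightarrow> F r) (at r within {0..})" "(v \<longlongrightarrow> v r) (at r within {0..})"
        using Fc v_cont r by (simp_all add: continuous_on_def)
      note this[unfolded at[OF r0]]
      then have "((\<lambda>r. - (F r - real n / r * v r)) \<longlongrightarrow> - (F r - real n / r * v r)) (at r)"
        using False by (intro tendsto_intros) auto
      moreover have "eventually (\<lambda>s. - (F s - real n / s * v s) = u2 s) (at r)"
      proof -
        have "eventually (\<lambda>s. 0 < s) (at r)"
          using r0 by (intro order_tendstoD(1)[OF tendsto_ident_at])
        then show ?thesis by eventually_elim (simp add: u2_def)
      qed
      ultimately have "(u2 \<longlongrightarrow> u2 r) (at r)"
        using Lim_transform_eventually False by (force simp: u2_def)
      then show ?thesis using at[OF r0] by simp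
    qed
  qed
  have "- u2 r - (real N - 1) / r * - v r
      = \<bar>u r\<bar> powr (p - 1) * u r + - m * \<bar>- v r\<bar> powr (2 * p / (p + 1))" if r: "0 < r" for r
  proof -
    have "\<bar>u r\<bar> powr (p - 1) * u r = u r powr p"
      using u_pos[of r] r by (simp add: powr_mult_base mult.commute)
    moreover have "\<bar>- v r\<bar> powr (2 * p / (p + 1)) = v r powr q"
      using v_ge[of r] r by (simp add: q_def)
    ultimately show ?thesis
      using F_eq[of r] u_pos[of r] r n by (simp add: u2_def)
  qed
  then have "ground_state N p (- m) u"
    unfolding ground_state_def using u_pos du du1 u2_cont v_0
    by (intro conjI exI[of _ "\<lambda>r. - v r"] exI[of _ u2]) (auto intro: less_imp_le)
  moreover have "\<exists>r\<ge>0. u r \<noteq> 0" using u_0 by (intro exI[of _ 0]) simp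
  ultimately show ?thesis by blast
qed

end

theorem theorem4p11:
  fixes N :: nat and p M :: real
  assumes "M < 0" and "N \<ge> 3" and "p \<ge> (real N + 2) / (real N - 2)"
  shows "(\<exists>u. ground_state N p M u \<and> (\<exists>r\<ge>0. u r \<noteq> 0)) \<and>
         (\<forall>u. ground_state N p M u \<and> (\<exists>r\<ge>0. u r \<noteq> 0) \<longrightarrow>
                u \<sim>[at_top] U_M N p M)"
proof -
  interpret supercritical N p "- M"
    using assms by unfold_locales auto
  show ?thesis
    using ground_state_exists ground_state_asymptotics by simp
qed

end
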